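(* Let $H$ be a Hopf algebra with bijective antipode $S$ over a field $k$, let $\alpha,\beta\in\mathrm{Aut}_{Hopf}(H)$, and assume that there exists a pair in involution $(f,g)$ corresponding to $(\alpha,\beta)$. Then the categories ${}_H\mathcal{YD}^H(\alpha,\beta)$ and ${}_H\mathcal{YD}^H$ are isomorphic. A pair of inverse functors $(F,G)$ is given as follows. If $M\in{}_H\mathcal{YD}^H(\alpha,\beta)$, then $F(M)\in{}_H\mathcal{YD}^H$, where $F(M)=M$ as vector space, with structures $$h\rightarrow m=f(\beta^{-1}(S(h_1)))\,\beta^{-1}(h_2)\cdot m,\qquad m\mapsto m_{<0>}\otimes m_{<1>}=m_{(0)}\otimes m_{(1)}g^{-1}.$$ If $N\in{}_H\mathcal{YD}^H$, then $G(N)\in{}_H\mathcal{YD}^H(\alpha,\beta)$, where $G(N)=N$ as vector space, with structures $$h\rightharpoonup n=f(h_1)\,\beta(h_2)\cdot n,\qquad n\mapsto n^{(0)}\otimes n^{(1)}=n_{(0)}\otimes n_{(1)}g.$$ Both $F$ and $G$ act as identities on morphisms.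
   Context: $\otimes=\otimes_k$; Sweedler notation $\Delta(h)=h_1\otimes h_2$; $\mathrm{Aut}_{Hopf}(H)$ is the group of Hopf algebra automorphisms of $H$. For $\alpha,\beta\in \mathrm{Aut}_{Hopf}(H)$, an $(\alpha,\beta)$-Yetter-Drinfeld module over $H$ is a vector space $M$ that is a left $H$-module ($h\otimes m\mapsto h\cdot m$) and a right $H$-comodule ($m\mapsto m_{(0)}\otimes m_{(1)}\in M\otimes H$) such that for all $h\in H$, $m\in M$: $$(h\cdot m)_{(0)}\otimes (h\cdot m)_{(1)}=h_2\cdot m_{(0)}\otimes \beta(h_3)\,m_{(1)}\,\alpha(S^{-1}(h_1)).$$ ${}_H\mathcal{YD}^H(\alpha,\beta)$ is the category of these, with $H$-linear $H$-colinear maps as morphisms; ${}_H\mathcal{YD}^H={}_H\mathcal{YD}^H(\mathrm{id},\mathrm{id})$ is the category of usual (left-right) Yetter-Drinfeld modules. A pair in involution corresponding to $(\alpha,\beta)$ is a pair $(f,g)$ with $f:H\to k$ an algebra map and $g\in H$ a group-like element such that $\alpha(h)=g^{-1}f(h_1)\beta(h_2)f(S(h_3))g$ for all $h\in H$. *)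

theory Defs
  imports "HOL-Algebra.Module"
begin

section \<open>Tensor products\<close>

text \<open>
  A formal sum \<open>v\<^sub>1 \<otimes> w\<^sub>1 + \<dots> + v\<^sub>n \<otimes> w\<^sub>n\<close> is written as the list of the pairs \<open>(v\<^sub>i, w\<^sub>i)\<close>.
  The tensor product of two modules over a commutative ring \<open>K\<close> is the free commutative monoid
  on the pairs modulo the congruence generated by bilinearity. The congruence identifies
  \<open>0 \<otimes> w\<close> with the empty sum, so every \<open>(v, w)\<close> has the additive inverse \<open>(-v, w)\<close>, and
  the quotient is the usual abelian group \<open>V \<otimes>\<^sub>K W\<close>.
\<close>

type_synonym ('v, 'w) tensor = "('v \<times> 'w) list set"

inductive tensor_eq ::
  "('k, 'r) ring_scheme \<Rightarrow> ('k, 'v, 's) module_scheme \<Rightarrow> ('k, 'w, 't) module_scheme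
    \<Rightarrow> ('v \<times> 'w) list \<Rightarrow> ('v \<times> 'w) list \<Rightarrow> bool"
  for K and V and W where
  refl: "xs \<in> lists (carrier V \<times> carrier W) \<Longrightarrow> tensor_eq K V W xs xs"
| sym: "tensor_eq K V W xs ys \<Longrightarrow> tensor_eq K V W ys xs"
| trans: "tensor_eq K V W xs ys \<Longrightarrow> tensor_eq K V W ys zs \<Longrightarrow> tensor_eq K V W xs zs"
| append: "tensor_eq K V W xs xs' \<Longrightarrow> tensor_eq K V W ys ys'
    \<Longrightarrow> tensor_eq K V W (xs @ ys) (xs' @ ys')"
| commute: "p \<in> carrier V \<times> carrier W \<Longrightarrow> q \<in> carrier V \<times> carrier W
    \<Longrightarrow> tensor_eq K V W [p, q] [q, p]"
| zero: "w \<in> carrier W \<Longrightarrow> tensor_eq K V W [(\<zero>\<^bsub>V\<^esub>, w)] []"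
| add_left: "v \<in> carrier V \<Longrightarrow> v' \<in> carrier V \<Longrightarrow> w \<in> carrier W
    \<Longrightarrow> tensor_eq K V W [(v \<oplus>\<^bsub>V\<^esub> v', w)] [(v, w), (v', w)]"
| add_right: "v \<in> carrier V \<Longrightarrow> w \<in> carrier W \<Longrightarrow> w' \<in> carrier W
    \<Longrightarrow> tensor_eq K V W [(v, w \<oplus>\<^bsub>W\<^esub> w')] [(v, w), (v, w')]"
| smult: "k \<in> carrier K \<Longrightarrow> v \<in> carrier V \<Longrightarrow> w \<in> carrier W
    \<Longrightarrow> tensor_eq K V W [(k \<odot>\<^bsub>V\<^esub> v, w)] [(v, k \<odot>\<^bsub>W\<^esub> w)]"

definition tensor_class ::
  "('k, 'r) ring_scheme \<Rightarrow> ('k, 'v, 's) module_scheme \<Rightarrow> ('k, 'w, 't) module_scheme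
    \<Rightarrow> ('v \<times> 'w) list \<Rightarrow> ('v, 'w) tensor"
  where "tensor_class K V W xs = {ys. tensor_eq K V W xs ys}"

definition rep :: "('v, 'w) tensor \<Rightarrow> ('v \<times> 'w) list"
  where "rep t = (SOME xs. xs \<in> t)"

text \<open>
  The operations are computed on representatives. The ring structure (\<open>mult\<close> and \<open>one\<close>)
  is the one of the tensor product of two algebras; it carries no meaning if \<open>V\<close> or \<open>W\<close>
  is merely a module.
\<close>

definition tensor ::
  "('k, 'r) ring_scheme \<Rightarrow> ('k, 'v, 's) module_scheme \<Rightarrow> ('k, 'w, 't) module_scheme
    \<Rightarrow> ('k, ('v, 'w) tensor) module"
  where "tensor K V W =
    \<lparr>carrier = tensor_class K V W ` lists (carrier V \<times> carrier W),
     mult = (\<lambda>s t. tensor_class K V W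
       [(a \<otimes>\<^bsub>V\<^esub> a', b \<otimes>\<^bsub>W\<^esub> b'). (a, b) \<leftarrow> rep s, (a', b') \<leftarrow> rep t]),
     one = tensor_class K V W [(\<one>\<^bsub>V\<^esub>, \<one>\<^bsub>W\<^esub>)],
     zero = tensor_class K V W [],
     add = (\<lambda>s t. tensor_class K V W (rep s @ rep t)),
     smult = (\<lambda>k t. tensor_class K V W (map (\<lambda>(v, w). (k \<odot>\<^bsub>V\<^esub> v, w)) (rep t)))\<rparr>"

definition pure_tensor ::
  "('k, 'r) ring_scheme \<Rightarrow> ('k, 'v, 's) module_scheme \<Rightarrow> ('k, 'w, 't) module_scheme
    \<Rightarrow> 'v \<Rightarrow> 'w \<Rightarrow> ('v, 'w) tensor"
  where "pure_tensor K V W v w = tensor_class K V W [(v, w)]"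

text \<open>
  \<open>tsum X t b\<close> is the sum \<open>\<Sum> b v\<^sub>i w\<^sub>i\<close> in \<open>X\<close> for \<open>t = \<Sum> v\<^sub>i \<otimes> w\<^sub>i\<close>, that is, the value at \<open>t\<close>
  of the linear map on the tensor product induced by a bilinear map \<open>b\<close>. It does not depend
  on the representative if \<open>b\<close> is bilinear, and it is only used for such \<open>b\<close>. Formulas in
  Sweedler notation are written with it.
\<close>

definition tsum :: "('x, 'r) ring_scheme \<Rightarrow> ('v, 'w) tensor \<Rightarrow> ('v \<Rightarrow> 'w \<Rightarrow> 'x) \<Rightarrow> 'x"
  where "tsum X t b = foldr (\<lambda>(v, w) x. b v w \<oplus>\<^bsub>X\<^esub> x) (rep t) \<zero>\<^bsub>X\<^esub>"

definition linear_map ::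
  "('k, 'r) ring_scheme \<Rightarrow> ('k, 'v, 's) module_scheme \<Rightarrow> ('k, 'w, 't) module_scheme
    \<Rightarrow> ('v \<Rightarrow> 'w) \<Rightarrow> bool"
  where "linear_map K V W u \<longleftrightarrow>
    u \<in> carrier V \<rightarrow> carrier W \<and>
    (\<forall>x\<in>carrier V. \<forall>y\<in>carrier V. u (x \<oplus>\<^bsub>V\<^esub> y) = u x \<oplus>\<^bsub>W\<^esub> u y) \<and>
    (\<forall>k\<in>carrier K. \<forall>x\<in>carrier V. u (k \<odot>\<^bsub>V\<^esub> x) = k \<odot>\<^bsub>W\<^esub> u x)"


section \<open>Hopf algebras\<close>

record ('k, 'h) hopf = "('k, 'h) module" +
  comult :: "'h \<Rightarrow> ('h, 'h) tensor"
  counit :: "'h \<Rightarrow> 'k"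
  antipode :: "'h \<Rightarrow> 'h"

text \<open>Sums over \<open>h\<^sub>1 \<otimes> h\<^sub>2 = \<Delta> h\<close> and over \<open>h\<^sub>1 \<otimes> h\<^sub>2 \<otimes> h\<^sub>3 = (id \<otimes> \<Delta>) (\<Delta> h)\<close>, with values in \<open>X\<close>.\<close>

definition sweedler2 ::
  "('k, 'h, 's) hopf_scheme \<Rightarrow> ('x, 'r) ring_scheme \<Rightarrow> 'h \<Rightarrow> ('h \<Rightarrow> 'h \<Rightarrow> 'x) \<Rightarrow> 'x"
  where "sweedler2 H X h b = tsum X (comult H h) b"

definition sweedler3 ::
  "('k, 'h, 's) hopf_scheme \<Rightarrow> ('x, 'r) ring_scheme \<Rightarrow> 'h \<Rightarrow> ('h \<Rightarrow> 'h \<Rightarrow> 'h \<Rightarrow> 'x) \<Rightarrow> 'x"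
  where "sweedler3 H X h c =
    sweedler2 H X h (\<lambda>h1 h'. sweedler2 H X h' (\<lambda>h2 h3. c h1 h2 h3))"

text \<open>Unital associative, not necessarily commutative algebras over a field.\<close>

definition assoc_algebra :: "('k, 'r) ring_scheme \<Rightarrow> ('k, 'h, 's) module_scheme \<Rightarrow> bool"
  where "assoc_algebra K A \<longleftrightarrow>
    field K \<and> module K A \<and> ring A \<and>
    (\<forall>k\<in>carrier K. \<forall>x\<in>carrier A. \<forall>y\<in>carrier A.
      (k \<odot>\<^bsub>A\<^esub> x) \<otimes>\<^bsub>A\<^esub> y = k \<odot>\<^bsub>A\<^esub> (x \<otimes>\<^bsub>A\<^esub> y) \<and>
      x \<otimes>\<^bsub>A\<^esub> (k \<odot>\<^bsub>A\<^esub> y) = k \<odot>\<^bsub>A\<^esub> (x \<otimes>\<^bsub>A\<^esub> y))"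

text \<open>Algebra maps \<open>A \<rightarrow> K\<close>.\<close>

definition character :: "('k, 'r) ring_scheme \<Rightarrow> ('k, 'h, 's) module_scheme \<Rightarrow> ('h \<Rightarrow> 'k) \<Rightarrow> bool"
  where "character K A f \<longleftrightarrow>
    f \<in> ring_hom A K \<and>
    (\<forall>k\<in>carrier K. \<forall>x\<in>carrier A. f (k \<odot>\<^bsub>A\<^esub> x) = k \<otimes>\<^bsub>K\<^esub> f x)"

definition coassociative :: "('k, 'r) ring_scheme \<Rightarrow> ('k, 'h, 's) hopf_scheme \<Rightarrow> bool"
  where "coassociative K H \<longleftrightarrow>
    (let HH = tensor K H H; HHH = tensor K H HH in
     \<forall>h\<in>carrier H.
       sweedler2 H HHH h (\<lambda>a b. sweedler2 H HHH a
         (\<lambda>a1 a2. pure_tensor K H HH a1 (pure_tensor K H H a2 b))) =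
       sweedler2 H HHH h (\<lambda>a b. pure_tensor K H HH a (comult H b)))"

definition bialgebra :: "('k, 'r) ring_scheme \<Rightarrow> ('k, 'h, 's) hopf_scheme \<Rightarrow> bool"
  where "bialgebra K H \<longleftrightarrow>
    assoc_algebra K H \<and>
    comult H \<in> ring_hom H (tensor K H H) \<and> linear_map K H (tensor K H H) (comult H) \<and>
    character K H (counit H) \<and>
    coassociative K H \<and>
    (\<forall>h\<in>carrier H.
      sweedler2 H H h (\<lambda>h1 h2. counit H h1 \<odot>\<^bsub>H\<^esub> h2) = h \<and>
      sweedler2 H H h (\<lambda>h1 h2. counit H h2 \<odot>\<^bsub>H\<^esub> h1) = h)"

definition hopf_algebra :: "('k, 'r) ring_scheme \<Rightarrow> ('k, 'h, 's) hopf_scheme \<Rightarrow> bool"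
  where "hopf_algebra K H \<longleftrightarrow>
    bialgebra K H \<and>
    linear_map K H H (antipode H) \<and>
    (\<forall>h\<in>carrier H.
      sweedler2 H H h (\<lambda>h1 h2. antipode H h1 \<otimes>\<^bsub>H\<^esub> h2) = counit H h \<odot>\<^bsub>H\<^esub> \<one>\<^bsub>H\<^esub> \<and>
      sweedler2 H H h (\<lambda>h1 h2. h1 \<otimes>\<^bsub>H\<^esub> antipode H h2) = counit H h \<odot>\<^bsub>H\<^esub> \<one>\<^bsub>H\<^esub>)"

text \<open>
  A Hopf algebra map is a map of algebras and of coalgebras; compatibility with the antipode
  is then automatic.
\<close>

definition hopf_aut :: "('k, 'r) ring_scheme \<Rightarrow> ('k, 'h, 's) hopf_scheme \<Rightarrow> ('h \<Rightarrow> 'h) set"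
  where "hopf_aut K H = {\<alpha>.
    bij_betw \<alpha> (carrier H) (carrier H) \<and>
    \<alpha> \<in> ring_hom H H \<and> linear_map K H H \<alpha> \<and>
    (\<forall>h\<in>carrier H.
      comult H (\<alpha> h) =
        sweedler2 H (tensor K H H) h (\<lambda>h1 h2. pure_tensor K H H (\<alpha> h1) (\<alpha> h2)) \<and>
      counit H (\<alpha> h) = counit H h)}"

abbreviation inv_on :: "('k, 'h, 's) hopf_scheme \<Rightarrow> ('h \<Rightarrow> 'h) \<Rightarrow> 'h \<Rightarrow> 'h"
  where "inv_on H \<equiv> inv_into (carrier H)"

definition group_like :: "('k, 'r) ring_scheme \<Rightarrow> ('k, 'h, 's) hopf_scheme \<Rightarrow> 'h \<Rightarrow> bool"
  where "group_like K H g \<longleftrightarrow>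
    g \<in> carrier H \<and> comult H g = pure_tensor K H H g g \<and> counit H g = \<one>\<^bsub>K\<^esub>"

definition pair_in_involution ::
  "('k, 'r) ring_scheme \<Rightarrow> ('k, 'h, 's) hopf_scheme \<Rightarrow> ('h \<Rightarrow> 'h) \<Rightarrow> ('h \<Rightarrow> 'h)
    \<Rightarrow> ('h \<Rightarrow> 'k) \<Rightarrow> 'h \<Rightarrow> bool"
  where "pair_in_involution K H \<alpha> \<beta> f g \<longleftrightarrow>
    character K H f \<and> group_like K H g \<and>
    (\<forall>h\<in>carrier H. \<alpha> h = sweedler3 H H h (\<lambda>h1 h2 h3.
      inv\<^bsub>H\<^esub> g \<otimes>\<^bsub>H\<^esub> (f h1 \<odot>\<^bsub>H\<^esub> (f (antipode H h3) \<odot>\<^bsub>H\<^esub> \<beta> h2)) \<otimes>\<^bsub>H\<^esub> g))"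


section \<open>Yetter--Drinfeld modules\<close>

record ('k, 'h, 'm) yd = "('k, 'm) module" +
  act :: "'h \<Rightarrow> 'm \<Rightarrow> 'm"
  coact :: "'m \<Rightarrow> ('m, 'h) tensor"

definition left_module ::
  "('k, 'r) ring_scheme \<Rightarrow> ('k, 'h, 's) hopf_scheme \<Rightarrow> ('k, 'h, 'm) yd \<Rightarrow> bool"
  where "left_module K H M \<longleftrightarrow>
    module K M \<and>
    (\<forall>h\<in>carrier H. linear_map K M M (act M h)) \<and>
    (\<forall>m\<in>carrier M. linear_map K H M (\<lambda>h. act M h m)) \<and>
    (\<forall>m\<in>carrier M. act M \<one>\<^bsub>H\<^esub> m = m) \<and>
    (\<forall>h\<in>carrier H. \<forall>h'\<in>carrier H. \<forall>m\<in>carrier M.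
      act M (h \<otimes>\<^bsub>H\<^esub> h') m = act M h (act M h' m))"

definition right_comodule ::
  "('k, 'r) ring_scheme \<Rightarrow> ('k, 'h, 's) hopf_scheme \<Rightarrow> ('k, 'h, 'm) yd \<Rightarrow> bool"
  where "right_comodule K H M \<longleftrightarrow>
    (let HH = tensor K H H; MHH = tensor K M HH in
     module K M \<and>
     linear_map K M (tensor K M H) (coact M) \<and>
     (\<forall>m\<in>carrier M.
       tsum MHH (coact M m) (\<lambda>m0 m1. tsum MHH (coact M m0)
         (\<lambda>n0 n1. pure_tensor K M HH n0 (pure_tensor K H H n1 m1))) =
       tsum MHH (coact M m) (\<lambda>m0 m1. pure_tensor K M HH m0 (comult H m1))) \<and>
     (\<forall>m\<in>carrier M. tsum M (coact M m) (\<lambda>m0 m1. counit H m1 \<odot>\<^bsub>M\<^esub> m0) = m))"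

definition yd_module ::
  "('k, 'r) ring_scheme \<Rightarrow> ('k, 'h, 's) hopf_scheme \<Rightarrow> ('h \<Rightarrow> 'h) \<Rightarrow> ('h \<Rightarrow> 'h)
    \<Rightarrow> ('k, 'h, 'm) yd \<Rightarrow> bool"
  where "yd_module K H \<alpha> \<beta> M \<longleftrightarrow>
    left_module K H M \<and> right_comodule K H M \<and>
    (\<forall>h\<in>carrier H. \<forall>m\<in>carrier M.
      coact M (act M h m) =
      sweedler3 H (tensor K M H) h (\<lambda>h1 h2 h3.
        tsum (tensor K M H) (coact M m) (\<lambda>m0 m1.
          pure_tensor K M H (act M h2 m0)
            (\<beta> h3 \<otimes>\<^bsub>H\<^esub> m1 \<otimes>\<^bsub>H\<^esub> \<alpha> (inv_on H (antipode H) h1)))))"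

text \<open>
  HOL functions are total and a module record has the unused components \<open>mult\<close> and \<open>one\<close>.
  Fixing all irrelevant values makes equality of records the equality of Yetter--Drinfeld
  modules, so that each of them is exactly one object of the category below.
\<close>

definition normalized :: "('k, 'r) ring_scheme \<Rightarrow> ('k, 'h, 's) hopf_scheme \<Rightarrow> ('k, 'h, 'm) yd \<Rightarrow> bool"
  where "normalized K H M \<longleftrightarrow>
    mult M = (\<lambda>_ _. undefined) \<and> one M = undefined \<and>
    (\<forall>x y. x \<notin> carrier M \<or> y \<notin> carrier M \<longrightarrow> x \<oplus>\<^bsub>M\<^esub> y = undefined) \<and>
    (\<forall>k x. k \<notin> carrier K \<or> x \<notin> carrier M \<longrightarrow> k \<odot>\<^bsub>M\<^esub> x = undefined) \<and>
    (\<forall>h x. h \<notin> carrier H \<or> x \<notin> carrier M \<longrightarrow> act M h x = undefined) \<and>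
    (\<forall>x. x \<notin> carrier M \<longrightarrow> coact M x = undefined)"

definition yd_hom ::
  "('k, 'r) ring_scheme \<Rightarrow> ('k, 'h, 's) hopf_scheme \<Rightarrow> ('k, 'h, 'm) yd \<Rightarrow> ('k, 'h, 'm) yd
    \<Rightarrow> ('m \<Rightarrow> 'm) set"
  where "yd_hom K H M N = {\<phi> \<in> extensional (carrier M).
    linear_map K M N \<phi> \<and>
    (\<forall>h\<in>carrier H. \<forall>m\<in>carrier M. \<phi> (act M h m) = act N h (\<phi> m)) \<and>
    (\<forall>m\<in>carrier M. coact N (\<phi> m) =
      tsum (tensor K N H) (coact M m) (\<lambda>m0 m1. pure_tensor K N H (\<phi> m0) m1))}"


section \<open>Categories\<close>

text \<open>\<open>Comp C a b c v u\<close> is the composite \<open>v \<circ> u\<close> of \<open>u : a \<rightarrow> b\<close> and \<open>v : b \<rightarrow> c\<close>.\<close>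

record ('o, 'a) category =
  Obj :: "'o set"
  Hom :: "'o \<Rightarrow> 'o \<Rightarrow> 'a set"
  Ident :: "'o \<Rightarrow> 'a"
  Comp :: "'o \<Rightarrow> 'o \<Rightarrow> 'o \<Rightarrow> 'a \<Rightarrow> 'a \<Rightarrow> 'a"

definition is_category :: "('o, 'a) category \<Rightarrow> bool"
  where "is_category C \<longleftrightarrow>
    (\<forall>a\<in>Obj C. Ident C a \<in> Hom C a a) \<and>
    (\<forall>a\<in>Obj C. \<forall>b\<in>Obj C. \<forall>c\<in>Obj C. \<forall>u\<in>Hom C a b. \<forall>v\<in>Hom C b c.
      Comp C a b c v u \<in> Hom C a c) \<and>
    (\<forall>a\<in>Obj C. \<forall>b\<in>Obj C. \<forall>u\<in>Hom C a b.
      Comp C a a b u (Ident C a) = u \<and> Comp C a b b (Ident C b) u = u) \<and>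
    (\<forall>a\<in>Obj C. \<forall>b\<in>Obj C. \<forall>c\<in>Obj C. \<forall>d\<in>Obj C.
      \<forall>u\<in>Hom C a b. \<forall>v\<in>Hom C b c. \<forall>w\<in>Hom C c d.
      Comp C a c d w (Comp C a b c v u) = Comp C a b d (Comp C b c d w v) u)"

text \<open>
  A functor is given by an object map and a family of maps \<open>Hom(a, b) \<rightarrow> Hom(F a, F b)\<close>.
\<close>

definition is_functor ::
  "('o, 'a) category \<Rightarrow> ('p, 'b) category \<Rightarrow> ('o \<Rightarrow> 'p) \<Rightarrow> ('o \<Rightarrow> 'o \<Rightarrow> 'a \<Rightarrow> 'b) \<Rightarrow> bool"
  where "is_functor C D F0 F1 \<longleftrightarrow>
    is_category C \<and> is_category D \<and>
    (\<forall>a\<in>Obj C. F0 a \<in> Obj D) \<and>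
    (\<forall>a\<in>Obj C. \<forall>b\<in>Obj C. \<forall>u\<in>Hom C a b. F1 a b u \<in> Hom D (F0 a) (F0 b)) \<and>
    (\<forall>a\<in>Obj C. F1 a a (Ident C a) = Ident D (F0 a)) \<and>
    (\<forall>a\<in>Obj C. \<forall>b\<in>Obj C. \<forall>c\<in>Obj C. \<forall>u\<in>Hom C a b. \<forall>v\<in>Hom C b c.
      F1 a c (Comp C a b c v u) = Comp D (F0 a) (F0 b) (F0 c) (F1 b c v) (F1 a b u))"

definition inverse_functors ::
  "('o, 'a) category \<Rightarrow> ('p, 'b) category \<Rightarrow> ('o \<Rightarrow> 'p) \<Rightarrow> ('o \<Rightarrow> 'o \<Rightarrow> 'a \<Rightarrow> 'b)
    \<Rightarrow> ('p \<Rightarrow> 'o) \<Rightarrow> ('p \<Rightarrow> 'p \<Rightarrow> 'b \<Rightarrow> 'a) \<Rightarrow> bool"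
  where "inverse_functors C D F0 F1 G0 G1 \<longleftrightarrow>
    is_functor C D F0 F1 \<and> is_functor D C G0 G1 \<and>
    (\<forall>a\<in>Obj C. G0 (F0 a) = a) \<and> (\<forall>a\<in>Obj D. F0 (G0 a) = a) \<and>
    (\<forall>a\<in>Obj C. \<forall>b\<in>Obj C. \<forall>u\<in>Hom C a b. G1 (F0 a) (F0 b) (F1 a b u) = u) \<and>
    (\<forall>a\<in>Obj D. \<forall>b\<in>Obj D. \<forall>u\<in>Hom D a b. F1 (G0 a) (G0 b) (G1 a b u) = u)"

definition isomorphic_categories :: "('o, 'a) category \<Rightarrow> ('p, 'b) category \<Rightarrow> bool"
  where "isomorphic_categories C D \<longleftrightarrow> (\<exists>F0 F1 G0 G1. inverse_functors C D F0 F1 G0 G1)"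

text \<open>
  The category of \<open>(\<alpha>, \<beta>)\<close>-Yetter--Drinfeld modules whose underlying set is a subset of the
  type \<open>'m\<close>.
\<close>

definition YD ::
  "('k, 'r) ring_scheme \<Rightarrow> ('k, 'h, 's) hopf_scheme \<Rightarrow> ('h \<Rightarrow> 'h) \<Rightarrow> ('h \<Rightarrow> 'h)
    \<Rightarrow> (('k, 'h, 'm) yd, 'm \<Rightarrow> 'm) category"
  where "YD K H \<alpha> \<beta> =
    \<lparr>Obj = {M. yd_module K H \<alpha> \<beta> M \<and> normalized K H M},
     Hom = yd_hom K H,
     Ident = (\<lambda>M. restrict id (carrier M)),
     Comp = (\<lambda>L M N \<psi> \<phi>. compose (carrier L) \<psi> \<phi>)\<rparr>"


section \<open>The two functors on objects\<close>

definition F_obj ::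
  "('k, 'r) ring_scheme \<Rightarrow> ('k, 'h, 's) hopf_scheme \<Rightarrow> ('h \<Rightarrow> 'h) \<Rightarrow> ('h \<Rightarrow> 'k) \<Rightarrow> 'h
    \<Rightarrow> ('k, 'h, 'm) yd \<Rightarrow> ('k, 'h, 'm) yd"
  where "F_obj K H \<beta> f g M = M
    \<lparr>act := (\<lambda>h m. if h \<in> carrier H \<and> m \<in> carrier M
       then sweedler2 H M h (\<lambda>h1 h2.
         f (inv_on H \<beta> (antipode H h1)) \<odot>\<^bsub>M\<^esub> act M (inv_on H \<beta> h2) m)
       else undefined),
     coact := (\<lambda>m\<in>carrier M. tsum (tensor K M H) (coact M m)
       (\<lambda>m0 m1. pure_tensor K M H m0 (m1 \<otimes>\<^bsub>H\<^esub> inv\<^bsub>H\<^esub> g)))\<rparr>"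

definition G_obj ::
  "('k, 'r) ring_scheme \<Rightarrow> ('k, 'h, 's) hopf_scheme \<Rightarrow> ('h \<Rightarrow> 'h) \<Rightarrow> ('h \<Rightarrow> 'k) \<Rightarrow> 'h
    \<Rightarrow> ('k, 'h, 'm) yd \<Rightarrow> ('k, 'h, 'm) yd"
  where "G_obj K H \<beta> f g N = N
    \<lparr>act := (\<lambda>h n. if h \<in> carrier H \<and> n \<in> carrier N
       then sweedler2 H N h (\<lambda>h1 h2. f h1 \<odot>\<^bsub>N\<^esub> act N (\<beta> h2) n)
       else undefined),
     coact := (\<lambda>n\<in>carrier N. tsum (tensor K N H) (coact N n)
       (\<lambda>n0 n1. pure_tensor K N H n0 (n1 \<otimes>\<^bsub>H\<^esub> g)))\<rparr>"

end

theory Submission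
  imports Defs
begin

text \<open>
  For a character \<open>u\<close> put \<open>\<lambda>\<^sub>u h = u(h\<^sub>1) h\<^sub>2\<close> and \<open>\<rho>\<^sub>u h = u(h\<^sub>2) h\<^sub>1\<close>. The map \<open>\<lambda>\<^sub>u\<close> is an algebra
  automorphism of \<open>H\<close> with inverse \<open>\<lambda>\<close> of \<open>u S\<close>, and \<open>\<lambda>\<^sub>u h\<^sub>1 \<otimes> h\<^sub>2 = \<Delta>(\<lambda>\<^sub>u h)\<close>,
  \<open>\<rho>\<^sub>u h\<^sub>1 \<otimes> h\<^sub>2 = h\<^sub>1 \<otimes> \<lambda>\<^sub>u h\<^sub>2\<close>. Both functors have the same shape: they pull the action back along
  \<open>\<theta> \<lambda>\<^sub>u\<close> for a Hopf automorphism \<open>\<theta>\<close> and multiply the coaction by a group-like element \<open>c\<close>. Such a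
  twist sends \<open>(\<alpha>, \<beta>)\<close>-modules to \<open>(\<alpha>', \<beta>')\<close>-modules as soon as \<open>\<beta> \<theta> = \<beta>'\<close> and
  \<open>\<alpha>(S\<^sup>-\<^sup>1(\<theta>(\<lambda>\<^sub>u h))) c = c \<alpha>'(S\<^sup>-\<^sup>1(\<rho>\<^sub>u h))\<close>. For \<open>F\<close> and \<open>G\<close> the last identity is \<open>S\<^sup>-\<^sup>1\<close> applied to
  a rearrangement of the equation defining a pair in involution.
\<close>

section \<open>Linear and bilinear maps\<close>

text \<open>For \<open>F\<close> the twist has \<theta> = \<beta>^-1, u = f \<beta>^-1 S and c =
  g^-1; for \<open>G\<close> it has \<theta> = \<beta>, u = f and c = g. The condition with \<rho>_u
  is forced by the Yetter-Drinfeld equation: evaluated at \<theta>(\<lambda>_u h), it has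
  \<lambda>_u on the leg h1 only, inside \<alpha> S^-1 and directly left of the factor c that the
  new coaction brings in. Carrying c across this factor turns \<lambda>_u h1 into \<rho>_u h1, and
  the exchange rule then hands the translation to h2, the leg that acts on the module, which is
  where the twisted action has it. The obstacle is that every Sweedler sum runs over an arbitrarily
  chosen representative of a tensor. The axioms of H and of a comodule, being equations between
  tensors, apply to a sum only once its summand is known to be bilinear or trilinear. The axioms are
  therefore restated as rules for arbitrary multilinear summands, and most side conditions are about
  linearity.\<close>

definition bilinear_map ::
  "('k, 'r) ring_scheme \<Rightarrow> ('k, 'v, 's) module_scheme \<Rightarrow> ('k, 'w, 't) module_scheme
    \<Rightarrow> ('k, 'x, 'u) module_scheme \<Rightarrow> ('v \<Rightarrow> 'w \<Rightarrow> 'x) \<Rightarrow> bool"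
  where "bilinear_map K V W X b \<longleftrightarrow>
    (\<forall>v\<in>carrier V. linear_map K W X (b v)) \<and>
    (\<forall>w\<in>carrier W. linear_map K V X (\<lambda>v. b v w))"

lemma linear_mapI:
  assumes "\<And>x. x \<in> carrier V \<Longrightarrow> u x \<in> carrier W"
    and "\<And>x y. x \<in> carrier V \<Longrightarrow> y \<in> carrier V \<Longrightarrow> u (x \<oplus>\<^bsub>V\<^esub> y) = u x \<oplus>\<^bsub>W\<^esub> u y"
    and "\<And>k x. k \<in> carrier K \<Longrightarrow> x \<in> carrier V \<Longrightarrow> u (k \<odot>\<^bsub>V\<^esub> x) = k \<odot>\<^bsub>W\<^esub> u x"
  shows "linear_map K V W u"
  using assms unfolding linear_map_def by auto

lemma linear_map_closed: "linear_map K V W u \<Longrightarrow> x \<in> carrier V \<Longrightarrow> u x \<in> carrier W"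
  unfolding linear_map_def by auto

lemma linear_map_add:
  "linear_map K V W u \<Longrightarrow> x \<in> carrier V \<Longrightarrow> y \<in> carrier V
    \<Longrightarrow> u (x \<oplus>\<^bsub>V\<^esub> y) = u x \<oplus>\<^bsub>W\<^esub> u y"
  unfolding linear_map_def by auto

lemma linear_map_smult:
  "linear_map K V W u \<Longrightarrow> k \<in> carrier K \<Longrightarrow> x \<in> carrier V \<Longrightarrow> u (k \<odot>\<^bsub>V\<^esub> x) = k \<odot>\<^bsub>W\<^esub> u x"
  unfolding linear_map_def by auto

lemma linear_map_cong:
  assumes "\<And>x. x \<in> carrier V \<Longrightarrow> u x = v x"
    and "\<And>x y. x \<in> carrier V \<Longrightarrow> y \<in> carrier V \<Longrightarrow> x \<oplus>\<^bsub>V\<^esub> y \<in> carrier V"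
    and "\<And>k x. k \<in> carrier K \<Longrightarrow> x \<in> carrier V \<Longrightarrow> k \<odot>\<^bsub>V\<^esub> x \<in> carrier V"
  shows "linear_map K V W u \<longleftrightarrow> linear_map K V W v"
  unfolding linear_map_def using assms by (auto simp: Pi_iff)

lemma linear_map_zero:
  assumes "linear_map K V W u" "module K V" "module K W"
  shows "u \<zero>\<^bsub>V\<^esub> = \<zero>\<^bsub>W\<^esub>"
proof -
  interpret V: module K V by fact
  interpret W: module K W by fact
  have "u \<zero>\<^bsub>V\<^esub> = u (\<zero>\<^bsub>K\<^esub> \<odot>\<^bsub>V\<^esub> \<zero>\<^bsub>V\<^esub>)" by simp
  also have "\<dots> = \<zero>\<^bsub>W\<^esub>"
    using assms(1) linear_map_closed[OF assms(1)] by (subst linear_map_smult) auto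
  finally show ?thesis .
qed

lemma linear_map_ident: "linear_map K V V (\<lambda>x. x)"
  by (auto simp: linear_map_def)

lemma linear_map_comp:
  "linear_map K V W u \<Longrightarrow> linear_map K U V v \<Longrightarrow> linear_map K U W (\<lambda>x. u (v x))"
  unfolding linear_map_def by (auto simp: Pi_iff)

lemma linear_map_const_smult:
  assumes "linear_map K V W u" "module K W" "k \<in> carrier K"
  shows "linear_map K V W (\<lambda>x. k \<odot>\<^bsub>W\<^esub> u x)"
proof -
  interpret W: module K W by fact
  show ?thesis
    using assms(1,3)
    by (auto intro!: linear_mapI simp: linear_map_closed linear_map_add linear_map_smult
        W.smult_r_distr W.smult_assoc1[symmetric] W.m_comm)
qed

lemma bilinear_mapI:
  assumes "\<And>v. v \<in> carrier V \<Longrightarrow> linear_map K W X (\<lambda>w. b v w)"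
    and "\<And>w. w \<in> carrier W \<Longrightarrow> linear_map K V X (\<lambda>v. b v w)"
  shows "bilinear_map K V W X b"
  using assms unfolding bilinear_map_def by auto

lemma bilinear_map_left:
  "bilinear_map K V W X b \<Longrightarrow> w \<in> carrier W \<Longrightarrow> linear_map K V X (\<lambda>v. b v w)"
  unfolding bilinear_map_def by auto

lemma bilinear_map_right:
  "bilinear_map K V W X b \<Longrightarrow> v \<in> carrier V \<Longrightarrow> linear_map K W X (\<lambda>w. b v w)"
  unfolding bilinear_map_def by auto

lemma bilinear_map_closed:
  "bilinear_map K V W X b \<Longrightarrow> v \<in> carrier V \<Longrightarrow> w \<in> carrier W \<Longrightarrow> b v w \<in> carrier X"
  by (metis bilinear_map_left linear_map_closed)

lemma bilinear_map_smult_left: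
  "bilinear_map K V W X b \<Longrightarrow> k \<in> carrier K \<Longrightarrow> v \<in> carrier V \<Longrightarrow> w \<in> carrier W
    \<Longrightarrow> b (k \<odot>\<^bsub>V\<^esub> v) w = k \<odot>\<^bsub>X\<^esub> b v w"
  using linear_map_smult[OF bilinear_map_left] by fast

lemma bilinear_map_smult_right:
  "bilinear_map K V W X b \<Longrightarrow> k \<in> carrier K \<Longrightarrow> v \<in> carrier V \<Longrightarrow> w \<in> carrier W
    \<Longrightarrow> b v (k \<odot>\<^bsub>W\<^esub> w) = k \<odot>\<^bsub>X\<^esub> b v w"
  using linear_map_smult[OF bilinear_map_right] by fast


section \<open>Sums over representatives\<close>

text \<open>The fold inside \<open>tsum\<close>, taken over an explicit list: facts about it go by
  induction on the list, while \<open>rep\<close> admits none.\<close>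

definition lsum :: "('x, 'r) ring_scheme \<Rightarrow> ('v \<Rightarrow> 'w \<Rightarrow> 'x) \<Rightarrow> ('v \<times> 'w) list \<Rightarrow> 'x"
  where "lsum X b xs = foldr (\<lambda>(v, w) x. b v w \<oplus>\<^bsub>X\<^esub> x) xs \<zero>\<^bsub>X\<^esub>"

lemma tsum_lsum: "tsum X t b = lsum X b (rep t)"
  by (simp add: tsum_def lsum_def)

lemma lsum_Nil [simp]: "lsum X b [] = \<zero>\<^bsub>X\<^esub>"
  by (simp add: lsum_def)

lemma lsum_Cons [simp]: "lsum X b (p # xs) = b (fst p) (snd p) \<oplus>\<^bsub>X\<^esub> lsum X b xs"
  by (simp add: lsum_def case_prod_beta)

context abelian_monoid
begin

lemma lsum_closed:
  "xs \<in> lists (C \<times> D) \<Longrightarrow> (\<And>v w. v \<in> C \<Longrightarrow> w \<in> D \<Longrightarrow> b v w \<in> carrier G)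
    \<Longrightarrow> lsum G b xs \<in> carrier G"
  by (induction xs) auto

lemma lsum_append:
  assumes "\<And>v w. v \<in> C \<Longrightarrow> w \<in> D \<Longrightarrow> b v w \<in> carrier G"
  shows "xs \<in> lists (C \<times> D) \<Longrightarrow> ys \<in> lists (C \<times> D)
    \<Longrightarrow> lsum G b (xs @ ys) = lsum G b xs \<oplus> lsum G b ys"
proof (induction xs)
  case Nil
  then show ?case using lsum_closed[of ys C D b] assms by simp
next
  case (Cons p xs)
  then show ?case
    using lsum_closed[of ys C D b] lsum_closed[of xs C D b] assms by (auto simp: a_assoc)
qed

lemma lsum_zero: "lsum G (\<lambda>v w. \<zero>) xs = \<zero>"
  by (induction xs) auto

lemma lsum_add:
  assumes "\<And>v w. v \<in> C \<Longrightarrow> w \<in> D \<Longrightarrow> b v w \<in> carrier G"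
    and "\<And>v w. v \<in> C \<Longrightarrow> w \<in> D \<Longrightarrow> c v w \<in> carrier G"
  shows "xs \<in> lists (C \<times> D)
    \<Longrightarrow> lsum G (\<lambda>v w. b v w \<oplus> c v w) xs = lsum G b xs \<oplus> lsum G c xs"
proof (induction xs)
  case (Cons p xs)
  then show ?case
    using lsum_closed[of xs C D b] lsum_closed[of xs C D c] assms by (auto simp: a_ac)
qed auto

text \<open>A plain exchange of finite sums over two fixed lists, which rests on associativity and
  commutativity of addition.\<close>

lemma lsum_swap:
  assumes "\<And>v w x y. v \<in> C \<Longrightarrow> w \<in> D \<Longrightarrow> x \<in> C' \<Longrightarrow> y \<in> D' \<Longrightarrow> b v w x y \<in> carrier G"
    and "ys \<in> lists (C' \<times> D')"
  shows "xs \<in> lists (C \<times> D)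
    \<Longrightarrow> lsum G (\<lambda>v w. lsum G (b v w) ys) xs = lsum G (\<lambda>x y. lsum G (\<lambda>v w. b v w x y) xs) ys"
proof (induction xs)
  case Nil
  then show ?case by (simp add: lsum_zero)
next
  case (Cons p xs)
  then have p: "fst p \<in> C" "snd p \<in> D" and xs: "xs \<in> lists (C \<times> D)" by auto
  have "lsum G (\<lambda>x y. lsum G (\<lambda>v w. b v w x y) (p # xs)) ys
      = lsum G (b (fst p) (snd p)) ys \<oplus> lsum G (\<lambda>x y. lsum G (\<lambda>v w. b v w x y) xs) ys"
    using assms p xs lsum_closed[of xs C D] by (auto intro!: lsum_add[of C' D'])
  then show ?case using Cons xs by simp
qed

end

lemma lsum_cong:
  assumes "xs \<in> lists (C \<times> D)" "\<And>v w. v \<in> C \<Longrightarrow> w \<in> D \<Longrightarrow> b v w = c v w"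
  shows "lsum X b xs = lsum X c xs"
  using assms(1) by (induction xs) (auto simp: assms(2))

lemma linear_map_lsum:
  assumes u: "linear_map K X Y u" and "module K X" "module K Y"
    and b: "\<And>v w. v \<in> C \<Longrightarrow> w \<in> D \<Longrightarrow> b v w \<in> carrier X"
  shows "xs \<in> lists (C \<times> D) \<Longrightarrow> u (lsum X b xs) = lsum Y (\<lambda>v w. u (b v w)) xs"
proof (induction xs)
  case Nil
  then show ?case by (simp add: linear_map_zero[OF assms(1-3)])
next
  case (Cons p xs)
  interpret X: module K X by fact
  show ?case using Cons b X.lsum_closed[of xs C D b] by (auto simp: linear_map_add[OF u])
qed


section \<open>The tensor product as a module\<close>

locale two_modules = V: module K V + W: module K W
  for K :: "('k, 'r) ring_scheme" (structure)
    and V :: "('k, 'v, 's) module_scheme" and W :: "('k, 'w, 't) module_scheme"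
begin

abbreviation "pairs \<equiv> lists (carrier V \<times> carrier W)"

lemma tensor_eq_pairs: "tensor_eq K V W xs ys \<Longrightarrow> xs \<in> pairs \<and> ys \<in> pairs"
  by (induction rule: tensor_eq.induct) auto

text \<open>A bilinear map respects every generating relation of the congruence: this is the
  universal property in list form.\<close>

lemma tensor_eq_lsum:
  assumes "module K X" and b: "bilinear_map K V W X b"
  shows "tensor_eq K V W xs ys \<Longrightarrow> lsum X b xs = lsum X b ys"
proof (induction rule: tensor_eq.induct)
  case (append xs xs' ys ys')
  interpret X: module K X by fact
  show ?case
    using append tensor_eq_pairs[OF append.hyps(1)] tensor_eq_pairs[OF append.hyps(2)]
      bilinear_map_closed[OF b] X.lsum_append[of "carrier V" "carrier W" b]
    by simp
next
  case (commute p q)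
  interpret X: module K X by fact
  from commute show ?case using bilinear_map_closed[OF b] by (auto simp: X.a_ac)
next
  case (zero w)
  interpret X: module K X by fact
  from zero show ?case
    using linear_map_zero[OF bilinear_map_left[OF b] V.module_axioms assms(1)] by auto
next
  case (add_left v v' w)
  interpret X: module K X by fact
  from add_left show ?case
    using linear_map_add[OF bilinear_map_left[OF b]] bilinear_map_closed[OF b]
    by (auto simp: X.a_assoc)
next
  case (add_right v w w')
  interpret X: module K X by fact
  from add_right show ?case
    using linear_map_add[OF bilinear_map_right[OF b]] bilinear_map_closed[OF b]
    by (auto simp: X.a_assoc)
next
  case (smult k v w)
  then show ?case
    using bilinear_map_smult_left[OF b] bilinear_map_smult_right[OF b] by auto
qed auto

lemma tensor_class_eqI:
  assumes "tensor_eq K V W xs ys"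
  shows "tensor_class K V W xs = tensor_class K V W ys"
  using assms unfolding tensor_class_def by (blast intro: tensor_eq.sym tensor_eq.trans)

text \<open>The congruence is reflexive only on lists of carrier pairs, so \<open>xs\<close> must be
  such a list in order to lie in its own class.\<close>

lemma tensor_class_eq_iff:
  assumes "xs \<in> pairs"
  shows "tensor_class K V W xs = tensor_class K V W ys \<longleftrightarrow> tensor_eq K V W xs ys"
proof
  assume "tensor_class K V W xs = tensor_class K V W ys"
  moreover have "xs \<in> tensor_class K V W xs"
    using assms by (simp add: tensor_class_def tensor_eq.refl)
  ultimately have "xs \<in> tensor_class K V W ys" by simp
  then show "tensor_eq K V W xs ys" by (simp add: tensor_class_def tensor_eq.sym)
qed (rule tensor_class_eqI)

text \<open>Links the operations of \<open>tensor\<close>, which work on the list chosen by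
  \<open>SOME\<close>, with computations on any given list.\<close>

lemma tensor_eq_rep: "xs \<in> pairs \<Longrightarrow> tensor_eq K V W xs (rep (tensor_class K V W xs))"
  unfolding rep_def tensor_class_def by (simp, rule someI[of _ xs], rule tensor_eq.refl)

lemma tensor_carrierE:
  assumes "t \<in> carrier (tensor K V W)"
  obtains xs where "xs \<in> pairs" "t = tensor_class K V W xs"
  using assms by (auto simp: tensor_def)

lemma rep_pairs:
  assumes "t \<in> carrier (tensor K V W)"
  shows "rep t \<in> pairs"
proof -
  obtain xs where xs: "xs \<in> pairs" "t = tensor_class K V W xs"
    using assms by (rule tensor_carrierE)
  then show ?thesis using tensor_eq_pairs[OF tensor_eq_rep[OF xs(1)]] by simp
qed

lemma tensor_class_rep:
  assumes "t \<in> carrier (tensor K V W)"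
  shows "tensor_class K V W (rep t) = t"
proof -
  obtain xs where xs: "xs \<in> pairs" "t = tensor_class K V W xs"
    using assms by (rule tensor_carrierE)
  then show ?thesis using tensor_class_eqI[OF tensor_eq_rep[OF xs(1)]] by simp
qed

lemma tensor_class_closed: "xs \<in> pairs \<Longrightarrow> tensor_class K V W xs \<in> carrier (tensor K V W)"
  by (simp add: tensor_def)

lemma pure_tensor_closed:
  "v \<in> carrier V \<Longrightarrow> w \<in> carrier W \<Longrightarrow> pure_tensor K V W v w \<in> carrier (tensor K V W)"
  by (simp add: pure_tensor_def tensor_class_closed)

lemma tensor_zero: "\<zero>\<^bsub>tensor K V W\<^esub> = tensor_class K V W []"
  by (simp add: tensor_def)

lemma tensor_add:
  assumes "xs \<in> pairs" "ys \<in> pairs"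
  shows "tensor_class K V W xs \<oplus>\<^bsub>tensor K V W\<^esub> tensor_class K V W ys = tensor_class K V W (xs @ ys)"
proof -
  have "tensor_eq K V W (xs @ ys)
      (rep (tensor_class K V W xs) @ rep (tensor_class K V W ys))"
    using assms by (intro tensor_eq.append tensor_eq_rep)
  then show ?thesis
    unfolding tensor_def by (simp add: tensor_class_eqI[OF tensor_eq.sym])
qed

abbreviation smult_pairs :: "'k \<Rightarrow> ('v \<times> 'w) list \<Rightarrow> ('v \<times> 'w) list"
  where "smult_pairs k \<equiv> map (\<lambda>(v, w). (k \<odot>\<^bsub>V\<^esub> v, w))"

lemma smult_pairs_closed: "k \<in> carrier K \<Longrightarrow> xs \<in> pairs \<Longrightarrow> smult_pairs k xs \<in> pairs"
  by (induction xs) auto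

text \<open>Makes scalar multiplication well defined on classes. The case \<open>smult\<close> uses
  that scalars commute.\<close>

lemma tensor_eq_smult_pairs:
  assumes k: "k \<in> carrier K"
  shows "tensor_eq K V W xs ys \<Longrightarrow> tensor_eq K V W (smult_pairs k xs) (smult_pairs k ys)"
proof (induction rule: tensor_eq.induct)
  case (refl xs)
  show ?case by (intro tensor_eq.refl smult_pairs_closed k refl)
next
  case (sym xs ys)
  from sym.IH show ?case by (rule tensor_eq.sym)
next
  case (trans xs ys zs)
  then show ?case by (blast intro: tensor_eq.trans)
next
  case (append xs xs' ys ys')
  show ?case unfolding map_append by (rule tensor_eq.append[OF append.IH])
next
  case (commute p q)
  then show ?case using k by (auto intro!: tensor_eq.commute)
next
  case (zero w)
  then show ?case using k by (simp add: tensor_eq.zero)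
next
  case (add_left v v' w)
  then show ?case using k by (simp add: V.smult_r_distr tensor_eq.add_left)
next
  case (add_right v w w')
  then show ?case using k by (simp add: tensor_eq.add_right)
next
  case (smult l v w)
  then show ?case
    using k tensor_eq.smult[of l K "k \<odot>\<^bsub>V\<^esub> v" V w W]
    by (simp add: V.smult_assoc1[symmetric] V.m_comm)
qed

lemma tensor_smult:
  assumes "k \<in> carrier K" "xs \<in> pairs"
  shows "k \<odot>\<^bsub>tensor K V W\<^esub> tensor_class K V W xs = tensor_class K V W (smult_pairs k xs)"
proof -
  have "tensor_eq K V W (smult_pairs k xs) (smult_pairs k (rep (tensor_class K V W xs)))"
    using assms by (intro tensor_eq_smult_pairs tensor_eq_rep)
  then show ?thesis
    unfolding tensor_def by (simp add: tensor_class_eqI[OF tensor_eq.sym])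
qed

text \<open>The generating relation swaps two single pairs only. One pair is first carried past a
  whole list, then the pairs of \<open>xs\<close> are carried across one by one.\<close>

lemma tensor_eq_commute_append:
  assumes "xs \<in> pairs" "ys \<in> pairs"
  shows "tensor_eq K V W (xs @ ys) (ys @ xs)"
proof -
  have *: "tensor_eq K V W (p # ys) (ys @ [p])" if "p \<in> carrier V \<times> carrier W" for p
    using assms(2)
  proof (induction ys)
    case Nil
    then show ?case using that by (auto intro!: tensor_eq.refl)
  next
    case (Cons q ys)
    then have "tensor_eq K V W ([p, q] @ ys) ([q, p] @ ys)"
      using that by (intro tensor_eq.append tensor_eq.commute tensor_eq.refl) auto
    moreover have "tensor_eq K V W ([q] @ (p # ys)) ([q] @ (ys @ [p]))"
      using Cons by (intro tensor_eq.append tensor_eq.refl) auto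
    ultimately show ?case by simp (erule (1) tensor_eq.trans)
  qed
  show ?thesis
    using assms(1)
  proof (induction xs)
    case Nil
    then show ?case using assms by (auto intro!: tensor_eq.refl)
  next
    case (Cons p xs)
    then have "tensor_eq K V W ([p] @ (xs @ ys)) ([p] @ (ys @ xs))"
      by (intro tensor_eq.append[OF tensor_eq.refl, of _ _ _ _ "xs @ ys"]) auto
    moreover have "tensor_eq K V W ((p # ys) @ xs) ((ys @ [p]) @ xs)"
      using Cons * by (intro tensor_eq.append tensor_eq.refl) auto
    ultimately show ?case by simp (erule (1) tensor_eq.trans)
  qed
qed

text \<open>Applies a relation to every summand at once. An empty value of \<open>q\<close> deletes
  summands and a two-element one splits them; \<open>tensor_module\<close> uses both.\<close>

lemma tensor_eq_map:
  assumes "xs \<in> pairs"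
    and "\<And>v w. v \<in> carrier V \<Longrightarrow> w \<in> carrier W \<Longrightarrow> tensor_eq K V W [p (v, w)] (q (v, w))"
  shows "tensor_eq K V W (map p xs) (concat (map q xs))"
  using assms(1)
proof (induction xs)
  case Nil
  then show ?case by (auto intro: tensor_eq.refl)
next
  case (Cons r xs)
  then have "tensor_eq K V W ([p r] @ map p xs) (q r @ concat (map q xs))"
    using assms(2)[of "fst r" "snd r"] by (intro tensor_eq.append) auto
  then show ?case by simp
qed

text \<open>Sorts the interleaved list that results from splitting each summand in two; only
  reordering is involved.\<close>

lemma tensor_eq_concat_pair:
  assumes "xs \<in> pairs" "p \<in> carrier V \<times> carrier W \<rightarrow> carrier V \<times> carrier W"
    "q \<in> carrier V \<times> carrier W \<rightarrow> carrier V \<times> carrier W"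
  shows "tensor_eq K V W (concat (map (\<lambda>r. [p r, q r]) xs)) (map p xs @ map q xs)"
  using assms(1)
proof (induction rule: lists.induct)
  case Nil
  then show ?case by (auto intro: tensor_eq.refl)
next
  case (Cons r xs)
  then have r: "p r \<in> carrier V \<times> carrier W" "q r \<in> carrier V \<times> carrier W"
    using assms(2,3) by auto
  have m: "map p xs \<in> pairs" "map q xs \<in> pairs"
    using Cons.hyps assms(2,3) by (induction xs) auto
  have IH: "tensor_eq K V W (concat (map (\<lambda>r. [p r, q r]) xs)) (map p xs @ map q xs)"
    using Cons by simp
  have "tensor_eq K V W ([p r, q r] @ concat (map (\<lambda>r. [p r, q r]) xs)) ([p r, q r] @ (map p xs @ map q xs))"
    using r IH by (intro tensor_eq.append tensor_eq.refl) auto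
  moreover have "tensor_eq K V W ([p r] @ (([q r] @ map p xs) @ map q xs)) ([p r] @ ((map p xs @ [q r]) @ map q xs))"
    using r m by (intro tensor_eq.append[OF tensor_eq.refl]
        tensor_eq.append[OF tensor_eq_commute_append tensor_eq.refl]) auto
  ultimately show ?case by simp (erule (1) tensor_eq.trans)
qed

lemma tensor_module: "module K (tensor K V W)"
proof -
  let ?T = "tensor K V W"
  \<comment> \<open>The inverse of \<open>xs\<close> negates all left factors. The list of the pairs
    \<open>(0, w)\<close> is the link: splitting 0 = -v + v gives \<open>xs\<close> together with
    its negative, deleting the pairs gives the empty sum.\<close>
  have inv: "\<exists>y\<in>carrier ?T. y \<oplus>\<^bsub>?T\<^esub> x = \<zero>\<^bsub>?T\<^esub>" if "x \<in> carrier ?T" for x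
  proof -
    from that obtain xs where xs: "xs \<in> pairs" "x = tensor_class K V W xs"
      by (rule tensor_carrierE)
    let ?m = "\<ominus> \<one>"
    have m: "smult_pairs ?m xs \<in> pairs" using xs by (intro smult_pairs_closed) auto
    have "tensor_eq K V W [(\<zero>\<^bsub>V\<^esub>, w)] [(?m \<odot>\<^bsub>V\<^esub> v, w), (v, w)]"
      if "v \<in> carrier V" "w \<in> carrier W" for v w
      using that tensor_eq.add_left[of "?m \<odot>\<^bsub>V\<^esub> v" V v w W K]
      by (simp add: V.smult_l_minus V.l_neg)
    then have "tensor_eq K V W (map (\<lambda>(v, w). (\<zero>\<^bsub>V\<^esub>, w)) xs)
        (concat (map (\<lambda>r. [case r of (v, w) \<Rightarrow> (?m \<odot>\<^bsub>V\<^esub> v, w), r]) xs))"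
      using xs(1) by (intro tensor_eq_map) auto
    moreover have "tensor_eq K V W (concat (map (\<lambda>r. [case r of (v, w) \<Rightarrow> (?m \<odot>\<^bsub>V\<^esub> v, w), r]) xs))
        (smult_pairs ?m xs @ map (\<lambda>r. r) xs)"
      using xs(1) by (intro tensor_eq_concat_pair) auto
    moreover have "tensor_eq K V W (map (\<lambda>(v, w). (\<zero>\<^bsub>V\<^esub>, w)) xs) (concat (map (\<lambda>r. []) xs))"
      using xs(1) by (intro tensor_eq_map) (auto intro: tensor_eq.zero)
    ultimately have "tensor_eq K V W (smult_pairs ?m xs @ map (\<lambda>r. r) xs) (concat (map (\<lambda>r. []) xs))"
      by (blast intro: tensor_eq.sym tensor_eq.trans)
    then have "tensor_eq K V W (smult_pairs ?m xs @ xs) []"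
      by (simp add: map_replicate_const)
    then have "tensor_class K V W (smult_pairs ?m xs) \<oplus>\<^bsub>?T\<^esub> x = \<zero>\<^bsub>?T\<^esub>"
      using m xs by (simp add: tensor_add tensor_zero tensor_class_eq_iff)
    then show ?thesis using m tensor_class_closed by blast
  qed
  have grp: "abelian_group ?T"
  proof (rule abelian_groupI)
    fix x y assume "x \<in> carrier ?T" "y \<in> carrier ?T"
    then obtain xs ys where *: "xs \<in> pairs" "x = tensor_class K V W xs"
        "ys \<in> pairs" "y = tensor_class K V W ys"
      by (metis tensor_carrierE)
    show "x \<oplus>\<^bsub>?T\<^esub> y \<in> carrier ?T" using * by (simp add: tensor_add tensor_class_closed)
    show "x \<oplus>\<^bsub>?T\<^esub> y = y \<oplus>\<^bsub>?T\<^esub> x"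
      using * by (simp add: tensor_add tensor_class_eq_iff tensor_eq_commute_append)
    fix z assume "z \<in> carrier ?T"
    then obtain zs where "zs \<in> pairs" "z = tensor_class K V W zs" by (rule tensor_carrierE)
    with * show "x \<oplus>\<^bsub>?T\<^esub> y \<oplus>\<^bsub>?T\<^esub> z = x \<oplus>\<^bsub>?T\<^esub> (y \<oplus>\<^bsub>?T\<^esub> z)" by (simp add: tensor_add)
  next
    show "\<zero>\<^bsub>?T\<^esub> \<in> carrier ?T" by (simp add: tensor_zero tensor_class_closed)
  next
    fix x assume "x \<in> carrier ?T"
    then obtain xs where "xs \<in> pairs" "x = tensor_class K V W xs" by (rule tensor_carrierE)
    then show "\<zero>\<^bsub>?T\<^esub> \<oplus>\<^bsub>?T\<^esub> x = x"
      by (simp add: tensor_zero tensor_add)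
  qed (rule inv)
  show ?thesis
  proof (rule moduleI[OF V.R.is_cring grp])
    fix a x y assume a: "a \<in> carrier K" and "x \<in> carrier ?T" "y \<in> carrier ?T"
    then obtain xs ys where *: "xs \<in> pairs" "x = tensor_class K V W xs"
        "ys \<in> pairs" "y = tensor_class K V W ys"
      by (metis tensor_carrierE)
    note [simp] = smult_pairs_closed tensor_smult tensor_add tensor_class_closed
    show "a \<odot>\<^bsub>?T\<^esub> (x \<oplus>\<^bsub>?T\<^esub> y) = a \<odot>\<^bsub>?T\<^esub> x \<oplus>\<^bsub>?T\<^esub> a \<odot>\<^bsub>?T\<^esub> y"
      using a * by simp
  next
    fix a x assume a: "a \<in> carrier K" and "x \<in> carrier ?T"
    then obtain xs where "xs \<in> pairs" "x = tensor_class K V W xs" by (metis tensor_carrierE)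
    then show "a \<odot>\<^bsub>?T\<^esub> x \<in> carrier ?T"
      using a by (simp add: smult_pairs_closed tensor_smult tensor_class_closed)
  next
    fix a b x assume a: "a \<in> carrier K" and b: "b \<in> carrier K" and "x \<in> carrier ?T"
    then obtain xs where *: "xs \<in> pairs" "x = tensor_class K V W xs" by (metis tensor_carrierE)
    have "smult_pairs (a \<otimes> b) xs = smult_pairs a (smult_pairs b xs)"
      using a b *(1) by (induction xs) (auto simp: V.smult_assoc1)
    then show "(a \<otimes> b) \<odot>\<^bsub>?T\<^esub> x = a \<odot>\<^bsub>?T\<^esub> (b \<odot>\<^bsub>?T\<^esub> x)"
      using a b * by (simp add: smult_pairs_closed tensor_smult del: map_map)
    \<comment> \<open>Each summand is split by additivity on the left, then the pieces are sorted
      into two blocks.\<close>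
    have "tensor_eq K V W (smult_pairs (a \<oplus> b) xs)
        (concat (map (\<lambda>r. [case r of (v, w) \<Rightarrow> (a \<odot>\<^bsub>V\<^esub> v, w), case r of (v, w) \<Rightarrow> (b \<odot>\<^bsub>V\<^esub> v, w)]) xs))"
      using a b *(1) by (intro tensor_eq_map) (auto simp: V.smult_l_distr intro: tensor_eq.add_left)
    moreover have "tensor_eq K V W
        (concat (map (\<lambda>r. [case r of (v, w) \<Rightarrow> (a \<odot>\<^bsub>V\<^esub> v, w), case r of (v, w) \<Rightarrow> (b \<odot>\<^bsub>V\<^esub> v, w)]) xs))
        (smult_pairs a xs @ smult_pairs b xs)"
      using a b *(1) by (intro tensor_eq_concat_pair) auto
    ultimately have "tensor_eq K V W (smult_pairs (a \<oplus> b) xs) (smult_pairs a xs @ smult_pairs b xs)"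
      by (rule tensor_eq.trans)
    then show "(a \<oplus> b) \<odot>\<^bsub>?T\<^esub> x = a \<odot>\<^bsub>?T\<^esub> x \<oplus>\<^bsub>?T\<^esub> b \<odot>\<^bsub>?T\<^esub> x"
      using a b * by (simp add: smult_pairs_closed tensor_smult tensor_add tensor_class_eq_iff)
  next
    fix x assume "x \<in> carrier ?T"
    then obtain xs where *: "xs \<in> pairs" "x = tensor_class K V W xs" by (metis tensor_carrierE)
    moreover have "smult_pairs \<one> xs = xs" using *(1) by (induction xs) auto
    ultimately show "\<one> \<odot>\<^bsub>?T\<^esub> x = x" by (simp add: tensor_smult)
  qed
qed

section \<open>Maps induced on the tensor product\<close>

lemma tsum_class:
  assumes "module K X" "bilinear_map K V W X b" "xs \<in> pairs"
  shows "tsum X (tensor_class K V W xs) b = lsum X b xs"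
  using tensor_eq_lsum[OF assms(1,2) tensor_eq_rep[OF assms(3)]] by (simp add: tsum_lsum)

lemma tsum_pure_tensor:
  assumes "module K X" "bilinear_map K V W X b" "v \<in> carrier V" "w \<in> carrier W"
  shows "tsum X (pure_tensor K V W v w) b = b v w"
proof -
  interpret X: module K X by fact
  show ?thesis
    using assms bilinear_map_closed[OF assms(2)] by (simp add: pure_tensor_def tsum_class)
qed

lemma bilinear_pure_tensor: "bilinear_map K V W (tensor K V W) (pure_tensor K V W)"
proof -
  interpret T: module K "tensor K V W" by (rule tensor_module)
  show ?thesis
    by (rule bilinear_mapI; rule linear_mapI)
      (simp_all add: pure_tensor_def tensor_class_closed tensor_add tensor_smult
        tensor_class_eq_iff tensor_eq.add_left tensor_eq.add_right tensor_eq.smult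
        tensor_eq.sym[OF tensor_eq.smult])
qed

lemma lsum_pure_tensor: "xs \<in> pairs \<Longrightarrow> lsum (tensor K V W) (pure_tensor K V W) xs = tensor_class K V W xs"
  by (induction xs) (auto simp: pure_tensor_def tensor_add tensor_zero)

text \<open>The linear map induced by \<open>pure_tensor\<close> is the identity. It lets a
  comultiplication or a coaction be written as a Sweedler sum and be recovered from one.\<close>

lemma tsum_eq_self: "t \<in> carrier (tensor K V W) \<Longrightarrow> tsum (tensor K V W) t (pure_tensor K V W) = t"
  by (simp add: tsum_lsum lsum_pure_tensor rep_pairs tensor_class_rep)

lemma tsum_closed:
  assumes "abelian_monoid X" "t \<in> carrier (tensor K V W)"
    and "\<And>v w. v \<in> carrier V \<Longrightarrow> w \<in> carrier W \<Longrightarrow> b v w \<in> carrier X"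
  shows "tsum X t b \<in> carrier X"
  using abelian_monoid.lsum_closed[OF assms(1) rep_pairs[OF assms(2)]] assms(3)
  by (simp add: tsum_lsum)

lemma tsum_cong:
  assumes "t \<in> carrier (tensor K V W)"
    and "\<And>v w. v \<in> carrier V \<Longrightarrow> w \<in> carrier W \<Longrightarrow> b v w = c v w"
  shows "tsum X t b = tsum X t c"
  unfolding tsum_lsum by (rule lsum_cong[OF rep_pairs[OF assms(1)] assms(2)])

lemma linear_map_tsum:
  assumes "linear_map K X Y u" "module K X" "module K Y" "t \<in> carrier (tensor K V W)"
    and "\<And>v w. v \<in> carrier V \<Longrightarrow> w \<in> carrier W \<Longrightarrow> b v w \<in> carrier X"
  shows "u (tsum X t b) = tsum Y t (\<lambda>v w. u (b v w))"
  using linear_map_lsum[OF assms(1-3) _ rep_pairs[OF assms(4)]] assms(5) by (simp add: tsum_lsum)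

text \<open>The tensor is fixed, so all sums run over the same list and linearity passes through
  them termwise. In \<open>linear_tsum\<close>, by contrast, the representatives of two tensors and
  of their sum are unrelated, and bilinearity has to mediate.\<close>

lemma linear_tsum_param:
  assumes "module K X" "module K U" "t \<in> carrier (tensor K V W)"
    and b: "\<And>v w. v \<in> carrier V \<Longrightarrow> w \<in> carrier W \<Longrightarrow> linear_map K U X (\<lambda>x. b x v w)"
  shows "linear_map K U X (\<lambda>x. tsum X t (b x))"
proof -
  interpret X: module K X by fact
  interpret U: module K U by fact
  note t = rep_pairs[OF assms(3)]
  show ?thesis
  proof (rule linear_mapI)
    fix x assume "x \<in> carrier U"
    then show "tsum X t (b x) \<in> carrier X"
      using X.lsum_closed[OF t] linear_map_closed[OF b] by (simp add: tsum_lsum)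
  next
    fix x y assume "x \<in> carrier U" "y \<in> carrier U"
    then show "tsum X t (b (x \<oplus>\<^bsub>U\<^esub> y)) = tsum X t (b x) \<oplus>\<^bsub>X\<^esub> tsum X t (b y)"
      using X.lsum_add[OF _ _ t, of "b x" "b y"] linear_map_closed[OF b] linear_map_add[OF b]
        lsum_cong[OF t, of "b (x \<oplus>\<^bsub>U\<^esub> y)" "\<lambda>v w. b x v w \<oplus>\<^bsub>X\<^esub> b y v w" X]
      by (simp add: tsum_lsum)
  next
    fix k x assume "k \<in> carrier K" "x \<in> carrier U"
    then show "tsum X t (b (k \<odot>\<^bsub>U\<^esub> x)) = k \<odot>\<^bsub>X\<^esub> tsum X t (b x)"
      using linear_map_closed[OF b] linear_map_smult[OF b]
        linear_map_lsum[OF linear_map_const_smult[OF linear_map_ident assms(1)] assms(1,1) _ t, of k "b x"]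
        lsum_cong[OF t, of "b (k \<odot>\<^bsub>U\<^esub> x)" "\<lambda>v w. k \<odot>\<^bsub>X\<^esub> b x v w" X]
      by (simp add: tsum_lsum)
  qed
qed

lemma linear_tsum:
  assumes "module K X" and b: "bilinear_map K V W X b"
  shows "linear_map K (tensor K V W) X (\<lambda>t. tsum X t b)"
proof -
  interpret X: module K X by fact
  show ?thesis
  proof (rule linear_mapI)
    fix x assume "x \<in> carrier (tensor K V W)"
    then show "tsum X x b \<in> carrier X"
      using tsum_closed[OF X.abelian_monoid_axioms] bilinear_map_closed[OF b] by blast
  next
    fix x y assume "x \<in> carrier (tensor K V W)" "y \<in> carrier (tensor K V W)"
    then show "tsum X (x \<oplus>\<^bsub>tensor K V W\<^esub> y) b = tsum X x b \<oplus>\<^bsub>X\<^esub> tsum X y b"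
      using bilinear_map_closed[OF b] X.lsum_append[of "carrier V" "carrier W" b]
      by (elim tensor_carrierE) (simp add: tensor_add tsum_class[OF assms])
  next
    fix k x assume k: "k \<in> carrier K" and "x \<in> carrier (tensor K V W)"
    then obtain xs where xs: "xs \<in> pairs" "x = tensor_class K V W xs" by (metis tensor_carrierE)
    have "lsum X b (smult_pairs k xs) = k \<odot>\<^bsub>X\<^esub> lsum X b xs"
      using xs(1)
    proof (induction xs)
      case (Cons p xs)
      then show ?case
        using k bilinear_map_closed[OF b] X.lsum_closed[of xs "carrier V" "carrier W" b]
        by (auto simp: X.smult_r_distr bilinear_map_smult_left[OF b])
    qed (use k in auto)
    then show "tsum X (k \<odot>\<^bsub>tensor K V W\<^esub> x) b = k \<odot>\<^bsub>X\<^esub> tsum X x b"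
      using k xs by (simp add: tensor_smult smult_pairs_closed tsum_class[OF assms])
  qed
qed

end

section \<open>Trilinear maps\<close>

definition trilinear_map ::
  "('k, 'r) ring_scheme \<Rightarrow> ('k, 'u, 'q) module_scheme \<Rightarrow> ('k, 'v, 's) module_scheme
    \<Rightarrow> ('k, 'w, 't) module_scheme \<Rightarrow> ('k, 'x, 'y) module_scheme \<Rightarrow> ('u \<Rightarrow> 'v \<Rightarrow> 'w \<Rightarrow> 'x) \<Rightarrow> bool"
  where "trilinear_map K U V W X c \<longleftrightarrow>
    (\<forall>u\<in>carrier U. bilinear_map K V W X (c u)) \<and>
    (\<forall>v\<in>carrier V. \<forall>w\<in>carrier W. linear_map K U X (\<lambda>u. c u v w))"

lemma trilinear_mapI:
  assumes "\<And>v w. v \<in> carrier V \<Longrightarrow> w \<in> carrier W \<Longrightarrow> linear_map K U X (\<lambda>u. c u v w)"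
    and "\<And>u w. u \<in> carrier U \<Longrightarrow> w \<in> carrier W \<Longrightarrow> linear_map K V X (\<lambda>v. c u v w)"
    and "\<And>u v. u \<in> carrier U \<Longrightarrow> v \<in> carrier V \<Longrightarrow> linear_map K W X (\<lambda>w. c u v w)"
  shows "trilinear_map K U V W X c"
  using assms unfolding trilinear_map_def bilinear_map_def by auto

text \<open>Together with \<open>linear_tsum\<close> it evaluates trilinear maps on an iterated
  tensor product, the form in which coassociativity is stated.\<close>

lemma (in two_modules) bilinear_tsum:
  assumes "module K U" "module K X" "trilinear_map K U V W X c"
  shows "bilinear_map K U (tensor K V W) X (\<lambda>u t. tsum X t (c u))"
  using assms W.module_axioms unfolding trilinear_map_def
  by (intro bilinear_mapI[of U K "tensor K V W"] linear_tsum linear_tsum_param) auto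


section \<open>Hopf algebras in Sweedler notation\<close>

locale hopf =
  fixes K :: "('k, 'r) ring_scheme" and H :: "('k, 'h, 's) hopf_scheme" (structure)
  assumes hopf: "hopf_algebra K H"
    and antipode_bij: "bij_betw (antipode H) (carrier H) (carrier H)"
begin

abbreviation "S \<equiv> antipode H"
abbreviation "\<epsilon> \<equiv> counit H"
abbreviation "HH \<equiv> tensor K H H"

lemma bialgebra: "bialgebra K H"
  using hopf by (simp add: hopf_algebra_def)

lemma assoc_algebra: "assoc_algebra K H"
  using bialgebra by (simp add: bialgebra_def)

end

sublocale hopf \<subseteq> K: field K
  using assoc_algebra by (simp add: assoc_algebra_def)

sublocale hopf \<subseteq> H: ring H
  using assoc_algebra by (simp add: assoc_algebra_def)

sublocale hopf \<subseteq> HH: two_modules K H H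
  using assoc_algebra by (simp add: assoc_algebra_def two_modules_def)

context hopf
begin

lemma module_H [simp]: "module K H" by (rule HH.V.module_axioms)

lemma module_HH [simp]: "module K HH" by (rule HH.tensor_module)

lemma smult_mult_left [simp]:
  "k \<in> carrier K \<Longrightarrow> x \<in> carrier H \<Longrightarrow> y \<in> carrier H \<Longrightarrow> (k \<odot> x) \<otimes> y = k \<odot> (x \<otimes> y)"
  using assoc_algebra by (simp add: assoc_algebra_def)

lemma smult_mult_right [simp]:
  "k \<in> carrier K \<Longrightarrow> x \<in> carrier H \<Longrightarrow> y \<in> carrier H \<Longrightarrow> x \<otimes> (k \<odot> y) = k \<odot> (x \<otimes> y)"
  using assoc_algebra by (simp add: assoc_algebra_def)

lemma smult_commute:
  assumes "module K X" "k \<in> carrier K" "l \<in> carrier K" "x \<in> carrier X"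
  shows "k \<odot>\<^bsub>X\<^esub> (l \<odot>\<^bsub>X\<^esub> x) = l \<odot>\<^bsub>X\<^esub> (k \<odot>\<^bsub>X\<^esub> x)"
  using assms by (metis module.smult_assoc1 K.m_comm)

lemma linear_comult: "linear_map K H HH (comult H)"
  using bialgebra by (simp add: bialgebra_def)

lemma comult_closed [simp]: "h \<in> carrier H \<Longrightarrow> comult H h \<in> carrier HH"
  by (rule linear_map_closed[OF linear_comult])

lemma linear_antipode: "linear_map K H H S"
  using hopf by (simp add: hopf_algebra_def)

lemma antipode_closed [simp]: "h \<in> carrier H \<Longrightarrow> S h \<in> carrier H"
  by (rule linear_map_closed[OF linear_antipode])

lemma character_counit [simp]: "character K H \<epsilon>"
  using bialgebra by (simp add: bialgebra_def)

lemma character_closed [simp]: "character K H u \<Longrightarrow> h \<in> carrier H \<Longrightarrow> u h \<in> carrier K"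
  unfolding character_def by (auto dest: ring_hom_closed)

lemma character_mult [simp]:
  "character K H u \<Longrightarrow> x \<in> carrier H \<Longrightarrow> y \<in> carrier H \<Longrightarrow> u (x \<otimes> y) = u x \<otimes>\<^bsub>K\<^esub> u y"
  unfolding character_def by (auto dest: ring_hom_mult)

lemma character_one [simp]: "character K H u \<Longrightarrow> u \<one> = \<one>\<^bsub>K\<^esub>"
  unfolding character_def by (auto dest: ring_hom_one)

lemma character_smult [simp]:
  "character K H u \<Longrightarrow> k \<in> carrier K \<Longrightarrow> x \<in> carrier H \<Longrightarrow> u (k \<odot> x) = k \<otimes>\<^bsub>K\<^esub> u x"
  unfolding character_def by auto

lemma character_add:
  "character K H u \<Longrightarrow> x \<in> carrier H \<Longrightarrow> y \<in> carrier H \<Longrightarrow> u (x \<oplus> y) = u x \<oplus>\<^bsub>K\<^esub> u y"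
  unfolding character_def by (auto dest: ring_hom_add)

lemma linear_mult_left:
  assumes "linear_map K U H u" "a \<in> carrier H"
  shows "linear_map K U H (\<lambda>x. a \<otimes> u x)"
  using assms by (auto intro!: linear_mapI simp: linear_map_closed linear_map_add linear_map_smult
      H.r_distr)

lemma linear_mult_right:
  assumes "linear_map K U H u" "a \<in> carrier H"
  shows "linear_map K U H (\<lambda>x. u x \<otimes> a)"
  using assms by (auto intro!: linear_mapI simp: linear_map_closed linear_map_add linear_map_smult
      H.l_distr)

lemma linear_character:
  assumes "linear_map K U H v" "character K H u" "module K X" "m \<in> carrier X"
  shows "linear_map K U X (\<lambda>x. u (v x) \<odot>\<^bsub>X\<^esub> m)"
proof -
  interpret X: module K X by fact
  show ?thesis
    using assms by (auto intro!: linear_mapI simp: linear_map_closed linear_map_add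
        linear_map_smult character_add X.smult_l_distr X.smult_assoc1)
qed

lemma module_const_smult [simp]:
  assumes "module K X" "k \<in> carrier K" "m \<in> carrier X"
  shows "k \<odot>\<^bsub>X\<^esub> m \<in> carrier X"
  using assms by (simp add: module.smult_closed)

lemma linear_pure_left:
  assumes "linear_map K U V u" "module K V" "module K W" "w \<in> carrier W"
  shows "linear_map K U (tensor K V W) (\<lambda>x. pure_tensor K V W (u x) w)"
  using assms two_modules.bilinear_pure_tensor[of K V W]
  by (auto intro!: linear_map_comp[OF _ assms(1)] bilinear_map_left simp: two_modules_def)

lemma linear_pure_right:
  assumes "linear_map K U W u" "module K V" "module K W" "v \<in> carrier V"
  shows "linear_map K U (tensor K V W) (\<lambda>x. pure_tensor K V W v (u x))"
  using assms two_modules.bilinear_pure_tensor[of K V W]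
  by (auto intro!: linear_map_comp[OF _ assms(1)] bilinear_map_right simp: two_modules_def)

lemmas linear_S = linear_map_comp[OF linear_antipode]

lemmas linear_counit = linear_character[OF _ character_counit]

text \<open>Introduction rules that reduce linearity of a Sweedler summand in one variable to its
  syntax; the multilinearity side conditions are solved with them.\<close>

lemmas linear = linear_map_ident linear_mult_left linear_mult_right linear_counit
  linear_map_const_smult linear_pure_left linear_pure_right linear_S

section \<open>Calculus of Sweedler sums\<close>

lemma sweedler2_closed [simp]:
  assumes "module K X" "h \<in> carrier H"
    and "\<And>a c. a \<in> carrier H \<Longrightarrow> c \<in> carrier H \<Longrightarrow> b a c \<in> carrier X"
  shows "sweedler2 H X h b \<in> carrier X"
proof -
  interpret X: module K X by fact
  show ?thesis
    unfolding sweedler2_def using assms by (intro HH.tsum_closed X.abelian_monoid_axioms) auto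
qed

lemma sweedler2_cong:
  assumes "h \<in> carrier H"
    and "\<And>a c. a \<in> carrier H \<Longrightarrow> c \<in> carrier H \<Longrightarrow> b a c = b' a c"
  shows "sweedler2 H X h b = sweedler2 H X h b'"
  unfolding sweedler2_def using assms by (intro HH.tsum_cong) auto

lemma linear_sweedler2:
  assumes "module K X" "bilinear_map K H H X b"
  shows "linear_map K H X (\<lambda>h. sweedler2 H X h b)"
  unfolding sweedler2_def
  by (rule linear_map_comp[OF HH.linear_tsum[OF assms] linear_comult])

lemma linear_sweedler2_param:
  assumes "module K X" "module K U" "h \<in> carrier H"
    and "\<And>a c. a \<in> carrier H \<Longrightarrow> c \<in> carrier H \<Longrightarrow> linear_map K U X (\<lambda>x. b x a c)"
  shows "linear_map K U X (\<lambda>x. sweedler2 H X h (b x))"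
  unfolding sweedler2_def using assms by (intro HH.linear_tsum_param) auto

lemma linear_map_sweedler2:
  assumes "linear_map K X Y u" "module K X" "module K Y" "h \<in> carrier H"
    and "\<And>a c. a \<in> carrier H \<Longrightarrow> c \<in> carrier H \<Longrightarrow> b a c \<in> carrier X"
  shows "u (sweedler2 H X h b) = sweedler2 H Y h (\<lambda>a c. u (b a c))"
  unfolding sweedler2_def using assms by (intro HH.linear_map_tsum) auto

lemma sweedler2_swap:
  assumes "module K X" "h \<in> carrier H" "h' \<in> carrier H"
    and "\<And>a c d e. a \<in> carrier H \<Longrightarrow> c \<in> carrier H \<Longrightarrow> d \<in> carrier H \<Longrightarrow> e \<in> carrier H
      \<Longrightarrow> b a c d e \<in> carrier X"
  shows "sweedler2 H X h (\<lambda>a c. sweedler2 H X h' (b a c))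
    = sweedler2 H X h' (\<lambda>d e. sweedler2 H X h (\<lambda>a c. b a c d e))"
proof -
  interpret X: module K X by fact
  show ?thesis
    unfolding sweedler2_def tsum_lsum using assms(2-4)
    by (intro X.lsum_swap[of "carrier H" "carrier H" "carrier H" "carrier H"] HH.rep_pairs comult_closed)
qed

text \<open>The trilinear map induces a linear map \<phi> on H tensor (H tensor H); applying \<phi>
  to the axiom, an equation between tensors, yields the rule for arbitrary summands.\<close>

lemma coassoc:
  assumes X: "module K X" and c: "trilinear_map K H H H X c" and h: "h \<in> carrier H"
  shows "sweedler2 H X h (\<lambda>q z. sweedler2 H X q (\<lambda>x y. c x y z))
    = sweedler2 H X h (\<lambda>x r. sweedler2 H X r (c x))"
proof -
  interpret HHH: two_modules K H HH by (simp add: two_modules_def)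
  let ?T = "tensor K H HH"
  define \<phi> where "\<phi> t = tsum X t (\<lambda>x s. tsum X s (c x))" for t
  have T: "module K ?T" by (rule HHH.tensor_module)
  have bil: "bilinear_map K H HH X (\<lambda>x s. tsum X s (c x))"
    using X c by (intro HH.bilinear_tsum) auto
  have bc: "bilinear_map K H H X (c x)" if "x \<in> carrier H" for x
    using c that by (auto simp: trilinear_map_def)
  have \<phi>: "linear_map K ?T X \<phi>" unfolding \<phi>_def by (rule HHH.linear_tsum[OF X bil])
  have pure: "\<phi> (pure_tensor K H HH x s) = tsum X s (c x)" if "x \<in> carrier H" "s \<in> carrier HH" for x s
    unfolding \<phi>_def using that by (rule HHH.tsum_pure_tensor[OF X bil])
  have "sweedler2 H ?T h (\<lambda>a b. sweedler2 H ?T a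
         (\<lambda>a1 a2. pure_tensor K H HH a1 (pure_tensor K H H a2 b))) =
       sweedler2 H ?T h (\<lambda>a b. pure_tensor K H HH a (comult H b))"
    using bialgebra h by (simp add: bialgebra_def coassociative_def Let_def)
  then have "\<phi> (sweedler2 H ?T h (\<lambda>a b. sweedler2 H ?T a
         (\<lambda>a1 a2. pure_tensor K H HH a1 (pure_tensor K H H a2 b)))) =
       \<phi> (sweedler2 H ?T h (\<lambda>a b. pure_tensor K H HH a (comult H b)))" by simp
  moreover have "\<phi> (sweedler2 H ?T h (\<lambda>a b. pure_tensor K H HH a (comult H b)))
      = sweedler2 H X h (\<lambda>x r. sweedler2 H X r (c x))"
    using h X T by (subst linear_map_sweedler2[OF \<phi>])
      (auto simp: pure sweedler2_def HHH.pure_tensor_closed intro!: HH.tsum_cong)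
  moreover have "\<phi> (sweedler2 H ?T h (\<lambda>a b. sweedler2 H ?T a
         (\<lambda>a1 a2. pure_tensor K H HH a1 (pure_tensor K H H a2 b))))
      = sweedler2 H X h (\<lambda>q z. sweedler2 H X q (\<lambda>x y. c x y z))"
    using h X T by (simp add: linear_map_sweedler2[OF \<phi>] HHH.pure_tensor_closed
        HH.pure_tensor_closed pure HH.tsum_pure_tensor bc cong: sweedler2_cong)
  ultimately show ?thesis by simp
qed

lemma counit_left:
  assumes "module K X" "linear_map K H X u" "h \<in> carrier H"
  shows "sweedler2 H X h (\<lambda>a c. \<epsilon> a \<odot>\<^bsub>X\<^esub> u c) = u h"
proof -
  have "u (sweedler2 H H h (\<lambda>a c. \<epsilon> a \<odot> c)) = sweedler2 H X h (\<lambda>a c. u (\<epsilon> a \<odot> c))"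
    using assms by (intro linear_map_sweedler2) auto
  also have "\<dots> = sweedler2 H X h (\<lambda>a c. \<epsilon> a \<odot>\<^bsub>X\<^esub> u c)"
    using assms by (intro sweedler2_cong) (auto simp: linear_map_smult)
  finally show ?thesis using bialgebra assms(3) by (simp add: bialgebra_def)
qed

text \<open>Read from right to left it splits off a new leg under a counit; an antipode axiom can
  then replace that counit by a product.\<close>

lemma counit_right:
  assumes "module K X" "linear_map K H X u" "h \<in> carrier H"
  shows "sweedler2 H X h (\<lambda>a c. \<epsilon> c \<odot>\<^bsub>X\<^esub> u a) = u h"
proof -
  have "u (sweedler2 H H h (\<lambda>a c. \<epsilon> c \<odot> a)) = sweedler2 H X h (\<lambda>a c. u (\<epsilon> c \<odot> a))"
    using assms by (intro linear_map_sweedler2) auto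
  also have "\<dots> = sweedler2 H X h (\<lambda>a c. \<epsilon> c \<odot>\<^bsub>X\<^esub> u a)"
    using assms by (intro sweedler2_cong) (auto simp: linear_map_smult)
  finally show ?thesis using bialgebra assms(3) by (simp add: bialgebra_def)
qed

lemma antipode_left: "h \<in> carrier H \<Longrightarrow> sweedler2 H H h (\<lambda>a c. S a \<otimes> c) = \<epsilon> h \<odot> \<one>"
  using hopf by (simp add: hopf_algebra_def)

lemma antipode_right: "h \<in> carrier H \<Longrightarrow> sweedler2 H H h (\<lambda>a c. a \<otimes> S c) = \<epsilon> h \<odot> \<one>"
  using hopf by (simp add: hopf_algebra_def)

lemma comult_one: "comult H \<one> = pure_tensor K H H \<one> \<one>"
proof -
  have "comult H \<in> ring_hom H HH" using bialgebra by (simp add: bialgebra_def)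
  then show ?thesis by (auto dest: ring_hom_one simp: tensor_def pure_tensor_def)
qed

lemma sweedler2_one:
  assumes "module K X" "bilinear_map K H H X b"
  shows "sweedler2 H X \<one> b = b \<one> \<one>"
  by (simp add: sweedler2_def comult_one HH.tsum_pure_tensor assms)

lemma (in abelian_monoid) lsum_concat:
  assumes "\<And>v w. v \<in> C \<Longrightarrow> w \<in> D \<Longrightarrow> b v w \<in> carrier G"
    and "\<And>v w. v \<in> C' \<Longrightarrow> w \<in> D' \<Longrightarrow> F (v, w) \<in> lists (C \<times> D)"
  shows "xs \<in> lists (C' \<times> D')
    \<Longrightarrow> lsum G b (concat (map F xs)) = lsum G (\<lambda>v w. lsum G b (F (v, w))) xs"
proof (induction rule: lists.induct)
  case (Cons p xs)
  then have "F p \<in> lists (C \<times> D)" using assms(2)[of "fst p" "snd p"] by auto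
  moreover have "concat (map F xs) \<in> lists (C \<times> D)"
    using Cons.hyps assms(2) by (induction xs) auto
  ultimately show ?case
    using Cons lsum_append[of C D b "F p" "concat (map F xs)"] assms(1) by simp
qed simp

lemma lsum_map: "lsum X b (map (\<lambda>(v, w). (p v w, q v w)) xs) = lsum X (\<lambda>v w. b (p v w) (q v w)) xs"
  by (induction xs) auto

text \<open>The product in \<open>tensor\<close> is the class of an explicit double list over the
  two chosen representatives; \<open>tsum_class\<close> evaluates the bilinear map on that list, and
  \<open>lsum_concat\<close> splits it into the two sums.\<close>

lemma sweedler2_mult:
  assumes X: "module K X" and b: "bilinear_map K H H X b" and "x \<in> carrier H" "y \<in> carrier H"
  shows "sweedler2 H X (x \<otimes> y) b
    = sweedler2 H X x (\<lambda>a c. sweedler2 H X y (\<lambda>a' c'. b (a \<otimes> a') (c \<otimes> c')))"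
proof -
  interpret X: module K X by fact
  have hom: "comult H \<in> ring_hom H HH" using bialgebra by (simp add: bialgebra_def)
  let ?F = "\<lambda>(a, c). map (\<lambda>(a', c'). (a \<otimes> a', c \<otimes> c')) (rep (comult H y))"
  have y: "rep (comult H y) \<in> HH.pairs" using assms by (intro HH.rep_pairs) auto
  have x: "rep (comult H x) \<in> HH.pairs" using assms by (intro HH.rep_pairs) auto
  have F: "?F (a, c) \<in> HH.pairs" if "a \<in> carrier H" "c \<in> carrier H" for a c
    using y that by (induction rule: lists.induct) auto
  have cc: "concat (map ?F (rep (comult H x))) \<in> HH.pairs"
    using x F by (induction rule: lists.induct) auto
  have "comult H (x \<otimes> y) = tensor_class K H H (concat (map ?F (rep (comult H x))))"
    using ring_hom_mult[OF hom assms(3,4)] by (simp add: tensor_def)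
  then have "sweedler2 H X (x \<otimes> y) b = lsum X b (concat (map ?F (rep (comult H x))))"
    using HH.tsum_class[OF X b cc] by (simp add: sweedler2_def)
  also have "\<dots> = lsum X (\<lambda>a c. lsum X b (?F (a, c))) (rep (comult H x))"
    by (rule X.lsum_concat[OF _ _ x, of "carrier H" "carrier H"])
      (rule bilinear_map_closed[OF b] F; assumption)+
  finally show ?thesis by (simp add: sweedler2_def tsum_lsum lsum_map)
qed


section \<open>The antipode\<close>

lemma antipode_one: "S \<one> = \<one>"
proof -
  have "S \<one> \<otimes> \<one> = sweedler2 H H \<one> (\<lambda>a c. S a \<otimes> c)"
    by (subst sweedler2_one) (auto intro!: bilinear_mapI linear)
  then show ?thesis by (simp add: antipode_left)
qed

lemma linear_sweedler2_comp:
  assumes "linear_map K U H u" "module K X" "bilinear_map K H H X b"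
  shows "linear_map K U X (\<lambda>x. sweedler2 H X (u x) b)"
  by (rule linear_map_comp[OF linear_sweedler2[OF assms(2,3)] assms(1)])

text \<open>On H tensor H, both S(xy) and S(y) S(x) invert the multiplication under convolution, the
  first from the left (\<open>inner_left\<close>), the second from the right
  (\<open>inner_right\<close>); hence they agree. The chain is this uniqueness argument written out
  in elements.\<close>

lemma antipode_mult:
  assumes x: "x \<in> carrier H" and y: "y \<in> carrier H"
  shows "S (x \<otimes> y) = S y \<otimes> S x"
proof -
  let ?sw = "sweedler2 H H"
  note lin = bilinear_mapI trilinear_mapI linear_sweedler2_param linear_sweedler2_comp linear
  have inner_left: "?sw p (\<lambda>x1 x2. ?sw q (\<lambda>y1 y2. S (x1 \<otimes> y1) \<otimes> (x2 \<otimes> y2)))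
      = \<epsilon> p \<odot> (\<epsilon> q \<odot> \<one>)" if "p \<in> carrier H" "q \<in> carrier H" for p q
  proof -
    have "?sw (p \<otimes> q) (\<lambda>a c. S a \<otimes> c)
        = ?sw p (\<lambda>x1 x2. ?sw q (\<lambda>y1 y2. S (x1 \<otimes> y1) \<otimes> (x2 \<otimes> y2)))"
      using that by (intro sweedler2_mult) (auto intro!: lin)
    then show ?thesis using that by (simp add: antipode_left HH.V.smult_assoc1)
  qed
  have inner_right: "?sw p (\<lambda>x1 x2. ?sw q (\<lambda>y1 y2. (x1 \<otimes> y1) \<otimes> (S y2 \<otimes> S x2)))
      = \<epsilon> p \<odot> (\<epsilon> q \<odot> \<one>)" if p: "p \<in> carrier H" and q: "q \<in> carrier H" for p q
  proof -
    have "?sw q (\<lambda>y1 y2. (x1 \<otimes> y1) \<otimes> (S y2 \<otimes> S x2)) = \<epsilon> q \<odot> (x1 \<otimes> S x2)"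
      if "x1 \<in> carrier H" "x2 \<in> carrier H" for x1 x2
    proof -
      have "x1 \<otimes> ?sw q (\<lambda>y1 y2. y1 \<otimes> S y2) \<otimes> S x2
          = ?sw q (\<lambda>y1 y2. x1 \<otimes> (y1 \<otimes> S y2) \<otimes> S x2)"
        using that q by (intro linear_map_sweedler2) (auto intro!: lin)
      also have "\<dots> = ?sw q (\<lambda>y1 y2. (x1 \<otimes> y1) \<otimes> (S y2 \<otimes> S x2))"
        using that q by (intro sweedler2_cong) (auto simp: H.m_assoc)
      finally show ?thesis using that q by (simp add: antipode_right)
    qed
    then have "?sw p (\<lambda>x1 x2. ?sw q (\<lambda>y1 y2. (x1 \<otimes> y1) \<otimes> (S y2 \<otimes> S x2)))
        = ?sw p (\<lambda>x1 x2. \<epsilon> q \<odot> (x1 \<otimes> S x2))"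
      using p by (intro sweedler2_cong)
    also have "\<dots> = \<epsilon> q \<odot> ?sw p (\<lambda>x1 x2. x1 \<otimes> S x2)"
      using p q by (intro linear_map_sweedler2[symmetric]) (auto intro!: lin)
    finally show ?thesis using p q by (simp add: antipode_right smult_commute)
  qed
  let ?E = "\<lambda>x1 x2 x3 y1 y2 y3. S (x1 \<otimes> y1) \<otimes> (x2 \<otimes> y2) \<otimes> (S y3 \<otimes> S x3)"
  have E: "?E x1 x2 x3 y1 y2 y3 = S (x1 \<otimes> y1) \<otimes> ((x2 \<otimes> y2) \<otimes> (S y3 \<otimes> S x3))"
    if "x1 \<in> carrier H" "x2 \<in> carrier H" "x3 \<in> carrier H"
      "y1 \<in> carrier H" "y2 \<in> carrier H" "y3 \<in> carrier H" for x1 x2 x3 y1 y2 y3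
    using that by (simp add: H.m_assoc)
  have "S (x \<otimes> y) = ?sw x (\<lambda>x1 r. \<epsilon> r \<odot> S (x1 \<otimes> y))"
    using x y by (intro counit_right[symmetric]) (auto intro!: lin)
  also have "\<dots> = ?sw x (\<lambda>x1 r. \<epsilon> r \<odot> ?sw y (\<lambda>y1 t. \<epsilon> t \<odot> S (x1 \<otimes> y1)))"
    using x y by (intro sweedler2_cong arg_cong[where f="(\<odot>) _"] counit_right[symmetric]) (auto intro!: lin)
  also have "\<dots> = ?sw x (\<lambda>x1 r. ?sw y (\<lambda>y1 t. \<epsilon> r \<odot> (\<epsilon> t \<odot> S (x1 \<otimes> y1))))"
    using x y by (intro sweedler2_cong linear_map_sweedler2) (auto intro!: lin)
  \<comment> \<open>The two counits are traded for \<open>inner_right\<close> read backwards, which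
    creates the second and third legs of \<open>x\<close> and \<open>y\<close>.\<close>
  also have "\<dots> = ?sw x (\<lambda>x1 r. ?sw y (\<lambda>y1 t. S (x1 \<otimes> y1) \<otimes>
      ?sw r (\<lambda>x2 x3. ?sw t (\<lambda>y2 y3. (x2 \<otimes> y2) \<otimes> (S y3 \<otimes> S x3)))))"
    using x y by (intro sweedler2_cong) (auto simp: inner_right)
  also have "\<dots> = ?sw x (\<lambda>x1 r. ?sw y (\<lambda>y1 t.
      ?sw r (\<lambda>x2 x3. ?sw t (\<lambda>y2 y3. ?E x1 x2 x3 y1 y2 y3))))"
    using x y by (simp add: E linear_map_sweedler2[OF linear_mult_left[OF linear_map_ident]] cong: sweedler2_cong)
  \<comment> \<open>Exchanging independent sums brings the two splittings of \<open>y\<close>, and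
    those of \<open>x\<close>, next to each other, so that coassociativity applies to each.\<close>
  also have "\<dots> = ?sw x (\<lambda>x1 r. ?sw r (\<lambda>x2 x3. ?sw y (\<lambda>y1 t. ?sw t (\<lambda>y2 y3. ?E x1 x2 x3 y1 y2 y3))))"
    using x y by (intro sweedler2_cong sweedler2_swap) auto
  also have "\<dots> = ?sw x (\<lambda>x1 r. ?sw r (\<lambda>x2 x3. ?sw y (\<lambda>q y3. ?sw q (\<lambda>y1 y2. ?E x1 x2 x3 y1 y2 y3))))"
    using x y by (intro sweedler2_cong coassoc[symmetric]) (auto intro!: lin)
  also have "\<dots> = ?sw x (\<lambda>p x3. ?sw p (\<lambda>x1 x2. ?sw y (\<lambda>q y3. ?sw q (\<lambda>y1 y2. ?E x1 x2 x3 y1 y2 y3))))"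
    using x y by (intro coassoc[symmetric]) (auto intro!: lin)
  also have "\<dots> = ?sw x (\<lambda>p x3. ?sw y (\<lambda>q y3. ?sw p (\<lambda>x1 x2. ?sw q (\<lambda>y1 y2. ?E x1 x2 x3 y1 y2 y3))))"
    using x y by (intro sweedler2_cong sweedler2_swap) auto
  also have "\<dots> = ?sw x (\<lambda>p x3. ?sw y (\<lambda>q y3. 
      ?sw p (\<lambda>x1 x2. ?sw q (\<lambda>y1 y2. S (x1 \<otimes> y1) \<otimes> (x2 \<otimes> y2))) \<otimes> (S y3 \<otimes> S x3)))"
    using x y by (simp add: linear_map_sweedler2[OF linear_mult_right[OF linear_map_ident]] cong: sweedler2_cong)
  also have "\<dots> = ?sw x (\<lambda>p x3. ?sw y (\<lambda>q y3. \<epsilon> p \<odot> (\<epsilon> q \<odot> (S y3 \<otimes> S x3))))"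
    using x y by (simp add: inner_left cong: sweedler2_cong)
  also have "\<dots> = ?sw x (\<lambda>p x3. \<epsilon> p \<odot> ?sw y (\<lambda>q y3. \<epsilon> q \<odot> (S y3 \<otimes> S x3)))"
    using x y by (intro sweedler2_cong linear_map_sweedler2[symmetric]) (auto intro!: lin)
  also have "\<dots> = ?sw x (\<lambda>p x3. \<epsilon> p \<odot> (S y \<otimes> S x3))"
    using x y by (intro sweedler2_cong arg_cong[where f="(\<odot>) _"] counit_left) (auto intro!: lin)
  also have "\<dots> = S y \<otimes> S x"
    using x y by (intro counit_left) (auto intro!: lin)
  finally show ?thesis .
qed

lemmas linear_sweedler =
  bilinear_mapI trilinear_mapI linear_sweedler2_param linear_sweedler2_comp linear

section \<open>The inverse of the antipode\<close>

definition inv_antipode :: "'h \<Rightarrow> 'h"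
  where "inv_antipode = inv_on H S"

lemma inv_antipode_closed [simp]: "h \<in> carrier H \<Longrightarrow> inv_antipode h \<in> carrier H"
  unfolding inv_antipode_def using antipode_bij
  by (metis bij_betw_imp_surj_on inv_into_into)

lemma antipode_inv_antipode [simp]: "h \<in> carrier H \<Longrightarrow> S (inv_antipode h) = h"
  unfolding inv_antipode_def using antipode_bij by (metis bij_betw_inv_into_right)

lemma inv_antipode_antipode [simp]: "h \<in> carrier H \<Longrightarrow> inv_antipode (S h) = h"
  unfolding inv_antipode_def using antipode_bij by (metis bij_betw_inv_into_left)

lemma inv_antipode_eqI: "h \<in> carrier H \<Longrightarrow> y = S h \<Longrightarrow> inv_antipode y = h"
  by simp

lemma linear_inv_antipode: "linear_map K H H inv_antipode"
  by (rule linear_mapI)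
    (auto intro!: inv_antipode_eqI simp: linear_map_add[OF linear_antipode]
      linear_map_smult[OF linear_antipode])

lemma inv_antipode_mult:
  "x \<in> carrier H \<Longrightarrow> y \<in> carrier H \<Longrightarrow> inv_antipode (x \<otimes> y) = inv_antipode y \<otimes> inv_antipode x"
  by (intro inv_antipode_eqI) (auto simp: antipode_mult)


section \<open>Translations by characters\<close>

text \<open>In the usual hit actions of the dual algebra on H, \<open>left_hit u h\<close> is the
  right action of u and \<open>right_hit u h\<close> the left action; the names refer to the tensor
  leg at which u is evaluated.\<close>

definition left_hit :: "('h \<Rightarrow> 'k) \<Rightarrow> 'h \<Rightarrow> 'h"
  where "left_hit u h = sweedler2 H H h (\<lambda>a c. u a \<odot> c)"

definition right_hit :: "('h \<Rightarrow> 'k) \<Rightarrow> 'h \<Rightarrow> 'h"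
  where "right_hit u h = sweedler2 H H h (\<lambda>a c. u c \<odot> a)"

lemma linear_left_hit:
  assumes u: "character K H u"
  shows "linear_map K H H (left_hit u)"
  unfolding left_hit_def
  by (rule linear_sweedler2) (use u in \<open>auto intro!: linear_sweedler linear_character[where u=u]\<close>)

lemma linear_right_hit:
  assumes u: "character K H u"
  shows "linear_map K H H (right_hit u)"
  unfolding right_hit_def
  by (rule linear_sweedler2) (use u in \<open>auto intro!: linear_sweedler linear_character[where u=u]\<close>)

lemma left_hit_closed [simp]: "character K H u \<Longrightarrow> h \<in> carrier H \<Longrightarrow> left_hit u h \<in> carrier H"
  by (rule linear_map_closed[OF linear_left_hit])

lemma right_hit_closed [simp]: "character K H u \<Longrightarrow> h \<in> carrier H \<Longrightarrow> right_hit u h \<in> carrier H"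
  by (rule linear_map_closed[OF linear_right_hit])

text \<open>By coassociativity both sides are the sum of u(h1) b(h2, h3).\<close>

lemma sweedler2_left_hit:
  assumes X: "module K X" and b: "bilinear_map K H H X b" and u: "character K H u"
    and h: "h \<in> carrier H"
  shows "sweedler2 H X (left_hit u h) b = sweedler2 H X h (\<lambda>a c. b (left_hit u a) c)"
proof -
  note [simp] = bilinear_map_closed[OF b] bilinear_map_smult_left[OF b] bilinear_map_smult_right[OF b]
  have bl: "linear_map K H X (\<lambda>x. b x c)" if "c \<in> carrier H" for c
    using b that by (rule bilinear_map_left)
  have br: "linear_map K H X (b a)" if "a \<in> carrier H" for a
    using bilinear_map_right[OF b that] .
  have "sweedler2 H X (left_hit u h) b = sweedler2 H X h (\<lambda>a r. sweedler2 H X (u a \<odot> r) b)"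
    unfolding left_hit_def using X u h
    by (intro linear_map_sweedler2[OF linear_sweedler2[OF X b]]) auto
  also have "\<dots> = sweedler2 H X h (\<lambda>a r. u a \<odot>\<^bsub>X\<^esub> sweedler2 H X r b)"
    using X u h by (intro sweedler2_cong linear_map_smult[OF linear_sweedler2[OF X b]]) auto
  also have "\<dots> = sweedler2 H X h (\<lambda>a r. sweedler2 H X r (\<lambda>c d. u a \<odot>\<^bsub>X\<^esub> b c d))"
    using X u h by (intro sweedler2_cong linear_map_sweedler2[OF linear_map_const_smult[OF linear_map_ident]]) auto
  also have "\<dots> = sweedler2 H X h (\<lambda>q d. sweedler2 H X q (\<lambda>a c. u a \<odot>\<^bsub>X\<^esub> b c d))"
    using X u h by (intro coassoc[symmetric] trilinear_mapI)
      (auto intro!: bl br linear linear_character[where u=u])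
  also have "\<dots> = sweedler2 H X h (\<lambda>q d. b (left_hit u q) d)"
    unfolding left_hit_def using X u h
    by (intro sweedler2_cong)
      (simp_all add: linear_map_sweedler2[where b="\<lambda>a c. u a \<odot> c", OF bl] cong: sweedler2_cong)
  finally show ?thesis .
qed

text \<open>By coassociativity both sides are the sum of u(h2) b(h1, h3).\<close>

lemma sweedler2_right_hit_left:
  assumes X: "module K X" and b: "bilinear_map K H H X b" and u: "character K H u"
    and h: "h \<in> carrier H"
  shows "sweedler2 H X h (\<lambda>a c. b (right_hit u a) c) = sweedler2 H X h (\<lambda>a c. b a (left_hit u c))"
proof -
  note [simp] = bilinear_map_closed[OF b] bilinear_map_smult_left[OF b] bilinear_map_smult_right[OF b]
  have bl: "linear_map K H X (\<lambda>x. b x c)" if "c \<in> carrier H" for c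
    using b that by (rule bilinear_map_left)
  have br: "linear_map K H X (b a)" if "a \<in> carrier H" for a
    using bilinear_map_right[OF b that] .
  have "sweedler2 H X h (\<lambda>q d. b (right_hit u q) d)
      = sweedler2 H X h (\<lambda>q d. sweedler2 H X q (\<lambda>a c. u c \<odot>\<^bsub>X\<^esub> b a d))"
    unfolding right_hit_def using X u h
    by (intro sweedler2_cong)
      (simp_all add: linear_map_sweedler2[where b="\<lambda>a c. u c \<odot> a", OF bl] cong: sweedler2_cong)
  also have "\<dots> = sweedler2 H X h (\<lambda>a r. sweedler2 H X r (\<lambda>c d. u c \<odot>\<^bsub>X\<^esub> b a d))"
    using X u h by (intro coassoc trilinear_mapI)
      (auto intro!: bl br linear linear_character[where u=u])
  also have "\<dots> = sweedler2 H X h (\<lambda>a r. b a (left_hit u r))"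
    unfolding left_hit_def using X u h
    by (intro sweedler2_cong)
      (simp_all add: linear_map_sweedler2[where b="\<lambda>a c. u a \<odot> c", OF br] cong: sweedler2_cong)
  finally show ?thesis .
qed

text \<open>Here u must be multiplicative, not just linear; the twisted action inherits its
  associativity from this.\<close>

lemma left_hit_mult:
  assumes u: "character K H u" and x: "x \<in> carrier H" and y: "y \<in> carrier H"
  shows "left_hit u (x \<otimes> y) = left_hit u x \<otimes> left_hit u y"
proof -
  let ?sw = "sweedler2 H H"
  have "left_hit u (x \<otimes> y) = ?sw x (\<lambda>a c. ?sw y (\<lambda>a' c'. u (a \<otimes> a') \<odot> (c \<otimes> c')))"
    unfolding left_hit_def using u x y
    by (intro sweedler2_mult) (auto intro!: linear_sweedler linear_character[where u=u])
  also have "\<dots> = ?sw x (\<lambda>a c. (u a \<odot> c) \<otimes> left_hit u y)"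
    unfolding left_hit_def using u x y
    by (simp add: linear_map_sweedler2[OF linear_mult_left[OF linear_map_ident]]
        HH.V.smult_assoc1 smult_commute linear_map_const_smult
        linear_map_sweedler2[OF linear_map_const_smult[OF linear_map_ident]] cong: sweedler2_cong)
  also have "\<dots> = left_hit u x \<otimes> left_hit u y"
    unfolding left_hit_def[of u x] using u x y
    by (intro linear_map_sweedler2[OF linear_mult_right[OF linear_map_ident], symmetric]) auto
  finally show ?thesis .
qed

lemma left_hit_one: "character K H u \<Longrightarrow> left_hit u \<one> = \<one>"
  unfolding left_hit_def
  by (subst sweedler2_one) (auto intro!: linear_sweedler linear_character[where u=u])

text \<open>Both sides are u(h1) v(h3) h2: the two characters use up opposite outer legs.\<close>

lemma left_right_hit_commute:
  assumes u: "character K H u" and v: "character K H v" and h: "h \<in> carrier H"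
  shows "left_hit u (right_hit v h) = right_hit v (left_hit u h)"
proof -
  have "right_hit v (left_hit u h) = sweedler2 H H h (\<lambda>a c. v c \<odot> left_hit u a)"
    unfolding right_hit_def using u v h
    by (intro sweedler2_left_hit) (auto intro!: linear_sweedler linear_character[where u=v])
  also have "\<dots> = left_hit u (right_hit v h)"
    unfolding right_hit_def using u v h
    by (simp add: linear_map_sweedler2[OF linear_left_hit] linear_map_smult[OF linear_left_hit] cong: sweedler2_cong)
  finally show ?thesis by simp
qed

text \<open>The scalar identity is multiplied by an auxiliary \<open>x\<close> because the rules for
  Sweedler sums take values in a module record, whereas K is only a ring record.\<close>

definition convolution_inverse :: "('h \<Rightarrow> 'k) \<Rightarrow> ('h \<Rightarrow> 'k) \<Rightarrow> bool"
  where "convolution_inverse u v \<longleftrightarrow> (\<forall>h\<in>carrier H. \<forall>x\<in>carrier H.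
    sweedler2 H H h (\<lambda>a c. u a \<odot> (v c \<odot> x)) = \<epsilon> h \<odot> x)"

text \<open>S reverses products, which makes no difference in the commutative ring K.\<close>

lemma character_antipode:
  assumes u: "character K H u"
  shows "character K H (\<lambda>h. u (S h))"
  using u linear_map_add[OF linear_antipode] linear_map_smult[OF linear_antipode]
  unfolding character_def[of _ _ "\<lambda>h. u (S h)"]
  by (auto intro!: ring_hom_memI simp: antipode_mult antipode_one K.m_comm character_add)

text \<open>u is applied to the two antipode axioms; being multiplicative, it separates the
  factors.\<close>

lemma convolution_inverse_antipode:
  assumes u: "character K H u"
  shows "convolution_inverse u (\<lambda>h. u (S h))" "convolution_inverse (\<lambda>h. u (S h)) u"
proof -
  have lin: "linear_map K H H (\<lambda>y. u y \<odot> x)" if "x \<in> carrier H" for x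
    using that u by (intro linear_character linear_map_ident) auto
  show "convolution_inverse u (\<lambda>h. u (S h))"
    unfolding convolution_inverse_def
  proof (intro ballI)
    fix h x assume h: "h \<in> carrier H" and x: "x \<in> carrier H"
    have "u (sweedler2 H H h (\<lambda>a c. a \<otimes> S c)) \<odot> x = sweedler2 H H h (\<lambda>a c. u (a \<otimes> S c) \<odot> x)"
      using h x by (intro linear_map_sweedler2[OF lin]) auto
    then show "sweedler2 H H h (\<lambda>a c. u a \<odot> (u (S c) \<odot> x)) = \<epsilon> h \<odot> x"
      using h x u by (simp add: antipode_right HH.V.smult_assoc1 cong: sweedler2_cong)
  qed
  show "convolution_inverse (\<lambda>h. u (S h)) u"
    unfolding convolution_inverse_def
  proof (intro ballI)
    fix h x assume h: "h \<in> carrier H" and x: "x \<in> carrier H"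
    have "u (sweedler2 H H h (\<lambda>a c. S a \<otimes> c)) \<odot> x = sweedler2 H H h (\<lambda>a c. u (S a \<otimes> c) \<odot> x)"
      using h x by (intro linear_map_sweedler2[OF lin]) auto
    then show "sweedler2 H H h (\<lambda>a c. u (S a) \<odot> (u c \<odot> x)) = \<epsilon> h \<odot> x"
      using h x u by (simp add: antipode_left HH.V.smult_assoc1 cong: sweedler2_cong)
  qed
qed

text \<open>The composite is u(h1) v(h2) h3, so \<open>u\<close> comes first in the convolution
  product.\<close>

lemma left_hit_inverse:
  assumes u: "character K H u" and v: "character K H v" and uv: "convolution_inverse u v"
    and h: "h \<in> carrier H"
  shows "left_hit v (left_hit u h) = h"
proof -
  let ?sw = "sweedler2 H H"
  have "left_hit v (left_hit u h) = ?sw h (\<lambda>a r. ?sw r (\<lambda>c d. u a \<odot> (v c \<odot> d)))"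
    unfolding left_hit_def[of u] using u v h
    by (simp add: linear_map_sweedler2[OF linear_left_hit] linear_map_smult[OF linear_left_hit] cong: sweedler2_cong)
      (simp add: left_hit_def linear_map_sweedler2[OF linear_map_const_smult[OF linear_map_ident]] cong: sweedler2_cong)
  also have "\<dots> = ?sw h (\<lambda>q d. ?sw q (\<lambda>a c. u a \<odot> (v c \<odot> d)))"
    using u v h by (intro coassoc[symmetric])
      (auto intro!: linear_sweedler linear_character[where u=u] linear_character[where u=v])
  also have "\<dots> = ?sw h (\<lambda>q d. \<epsilon> q \<odot> d)"
    using uv h by (intro sweedler2_cong) (auto simp: convolution_inverse_def)
  also have "\<dots> = h" using h by (intro counit_left) (auto intro: linear)
  finally show ?thesis .
qed

text \<open>The composite is v(h2) u(h3) h1: on this side the order of the convolution product is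
  reversed.\<close>

lemma right_hit_inverse:
  assumes u: "character K H u" and v: "character K H v" and vu: "convolution_inverse v u"
    and h: "h \<in> carrier H"
  shows "right_hit v (right_hit u h) = h"
proof -
  let ?sw = "sweedler2 H H"
  have "right_hit v (right_hit u h) = ?sw h (\<lambda>q d. ?sw q (\<lambda>a c. v c \<odot> (u d \<odot> a)))"
    unfolding right_hit_def[of u] using u v h
    by (simp add: linear_map_sweedler2[OF linear_right_hit] linear_map_smult[OF linear_right_hit] cong: sweedler2_cong)
      (simp add: right_hit_def linear_map_sweedler2[OF linear_map_const_smult[OF linear_map_ident]] smult_commute cong: sweedler2_cong)
  also have "\<dots> = ?sw h (\<lambda>a r. ?sw r (\<lambda>c d. v c \<odot> (u d \<odot> a)))"
    using u v h by (intro coassoc)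
      (auto intro!: linear_sweedler linear_character[where u=u] linear_character[where u=v])
  also have "\<dots> = ?sw h (\<lambda>a r. \<epsilon> r \<odot> a)"
    using vu h by (intro sweedler2_cong) (auto simp: convolution_inverse_def)
  also have "\<dots> = h" using h by (intro counit_right) (auto intro: linear)
  finally show ?thesis .
qed


section \<open>Hopf automorphisms, group-like elements and pairs in involution\<close>

lemma hopf_aut_linear: "\<theta> \<in> hopf_aut K H \<Longrightarrow> linear_map K H H \<theta>"
  by (simp add: hopf_aut_def)

lemma hopf_aut_closed: "\<theta> \<in> hopf_aut K H \<Longrightarrow> h \<in> carrier H \<Longrightarrow> \<theta> h \<in> carrier H"
  by (rule linear_map_closed[OF hopf_aut_linear])

lemma hopf_aut_mult:
  "\<theta> \<in> hopf_aut K H \<Longrightarrow> x \<in> carrier H \<Longrightarrow> y \<in> carrier H \<Longrightarrow> \<theta> (x \<otimes> y) = \<theta> x \<otimes> \<theta> y"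
  by (auto simp: hopf_aut_def dest: ring_hom_mult)

lemma hopf_aut_one: "\<theta> \<in> hopf_aut K H \<Longrightarrow> \<theta> \<one> = \<one>"
  by (auto simp: hopf_aut_def dest: ring_hom_one)

lemma hopf_aut_counit: "\<theta> \<in> hopf_aut K H \<Longrightarrow> h \<in> carrier H \<Longrightarrow> \<epsilon> (\<theta> h) = \<epsilon> h"
  by (simp add: hopf_aut_def)

lemma sweedler2_hopf_aut:
  assumes X: "module K X" and b: "bilinear_map K H H X b" and \<theta>: "\<theta> \<in> hopf_aut K H"
    and h: "h \<in> carrier H"
  shows "sweedler2 H X (\<theta> h) b = sweedler2 H X h (\<lambda>a c. b (\<theta> a) (\<theta> c))"
proof -
  note [simp] = hopf_aut_closed[OF \<theta>]
  have "comult H (\<theta> h) = sweedler2 H HH h (\<lambda>a c. pure_tensor K H H (\<theta> a) (\<theta> c))"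
    using \<theta> h by (simp add: hopf_aut_def)
  then have "sweedler2 H X (\<theta> h) b
      = tsum X (sweedler2 H HH h (\<lambda>a c. pure_tensor K H H (\<theta> a) (\<theta> c))) b"
    by (simp add: sweedler2_def)
  also have "\<dots> = sweedler2 H X h (\<lambda>a c. tsum X (pure_tensor K H H (\<theta> a) (\<theta> c)) b)"
    using X h by (intro linear_map_sweedler2[OF HH.linear_tsum[OF X b]])
      (auto intro: HH.pure_tensor_closed)
  also have "\<dots> = sweedler2 H X h (\<lambda>a c. b (\<theta> a) (\<theta> c))"
    using h by (intro sweedler2_cong) (auto intro!: HH.tsum_pure_tensor[OF X b])
  finally show ?thesis .
qed

text \<open>S \<theta> and \<theta> S are both convolution inverses of \<theta>. The chain inserts
  the product of \<theta> with \<theta> S, reassociates, and cancels S \<theta> against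
  \<theta>.\<close>

lemma hopf_aut_antipode:
  assumes \<theta>: "\<theta> \<in> hopf_aut K H" and h: "h \<in> carrier H"
  shows "S (\<theta> h) = \<theta> (S h)"
proof -
  let ?sw = "sweedler2 H H"
  note [simp] = hopf_aut_closed[OF \<theta>]
  note lin = hopf_aut_linear[OF \<theta>]
  note lins = linear_sweedler linear_map_comp[OF lin]
  have "S (\<theta> h) = ?sw h (\<lambda>a r. \<epsilon> r \<odot> S (\<theta> a))"
    using h by (intro counit_right[symmetric]) (auto intro!: lins)
  also have "\<dots> = ?sw h (\<lambda>a r. S (\<theta> a) \<otimes> \<theta> (?sw r (\<lambda>b c. b \<otimes> S c)))"
    using h by (intro sweedler2_cong)
      (simp_all add: antipode_right linear_map_smult[OF lin] hopf_aut_one[OF \<theta>])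
  also have "\<dots> = ?sw h (\<lambda>a r. S (\<theta> a) \<otimes> ?sw r (\<lambda>b c. \<theta> (b \<otimes> S c)))"
    using h by (intro sweedler2_cong arg_cong[where f="(\<otimes>) _"] linear_map_sweedler2[OF lin]) auto
  also have "\<dots> = ?sw h (\<lambda>a r. ?sw r (\<lambda>b c. S (\<theta> a) \<otimes> \<theta> (b \<otimes> S c)))"
    using h by (intro sweedler2_cong linear_map_sweedler2[OF linear_mult_left[OF linear_map_ident]]) auto
  also have "\<dots> = ?sw h (\<lambda>a r. ?sw r (\<lambda>b c. S (\<theta> a) \<otimes> \<theta> b \<otimes> \<theta> (S c)))"
    using h by (intro sweedler2_cong) (auto simp: hopf_aut_mult[OF \<theta>] H.m_assoc)
  also have "\<dots> = ?sw h (\<lambda>q c. ?sw q (\<lambda>a b. S (\<theta> a) \<otimes> \<theta> b \<otimes> \<theta> (S c)))"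
    using h by (intro coassoc[symmetric]) (auto intro!: lins)
  also have "\<dots> = ?sw h (\<lambda>q c. ?sw q (\<lambda>a b. S (\<theta> a) \<otimes> \<theta> b) \<otimes> \<theta> (S c))"
    using h by (intro sweedler2_cong linear_map_sweedler2[OF linear_mult_right[OF linear_map_ident], symmetric]) auto
  also have "\<dots> = ?sw h (\<lambda>q c. ?sw (\<theta> q) (\<lambda>a b. S a \<otimes> b) \<otimes> \<theta> (S c))"
    using h by (intro sweedler2_cong arg_cong[where f="\<lambda>x. x \<otimes> _"] sweedler2_hopf_aut[symmetric])
      (auto intro!: lins \<theta>)
  also have "\<dots> = ?sw h (\<lambda>q c. \<epsilon> q \<odot> \<theta> (S c))"
    using h by (intro sweedler2_cong) (simp_all add: antipode_left hopf_aut_counit[OF \<theta>])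
  also have "\<dots> = \<theta> (S h)"
    using h by (intro counit_left) (auto intro!: lins)
  finally show ?thesis .
qed

lemma hopf_aut_inv_antipode:
  assumes \<theta>: "\<theta> \<in> hopf_aut K H" and h: "h \<in> carrier H"
  shows "inv_antipode (\<theta> h) = \<theta> (inv_antipode h)"
  using h hopf_aut_antipode[OF \<theta>, of "inv_antipode h"] hopf_aut_closed[OF \<theta>]
  by (intro inv_antipode_eqI) auto

lemma id_hopf_aut: "id \<in> hopf_aut K H"
proof -
  have "sweedler2 H HH h (pure_tensor K H H) = comult H h" if "h \<in> carrier H" for h
    using that by (simp add: sweedler2_def HH.tsum_eq_self)
  then show ?thesis
    by (auto simp: hopf_aut_def linear_map_ident id_def bij_betw_def intro!: ring_hom_memI)
qed

lemma hopf_aut_inv_apply: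
  assumes "\<theta> \<in> hopf_aut K H" "h \<in> carrier H"
  shows "inv_on H \<theta> h \<in> carrier H" "\<theta> (inv_on H \<theta> h) = h" "inv_on H \<theta> (\<theta> h) = h"
  using assms unfolding hopf_aut_def
  by (auto simp: bij_betw_inv_into_right bij_betw_inv_into_left bij_betw_imp_surj_on intro!: inv_into_into)

lemma inv_hopf_aut:
  assumes \<theta>: "\<theta> \<in> hopf_aut K H"
  shows "inv_on H \<theta> \<in> hopf_aut K H"
proof -
  let ?\<gamma> = "inv_on H \<theta>"
  note [simp] = hopf_aut_inv_apply[OF \<theta>] hopf_aut_closed[OF \<theta>]
  have eqI: "?\<gamma> x = y" if "y \<in> carrier H" "x = \<theta> y" for x y
    using that by simp
  have lin: "linear_map K H H ?\<gamma>"
    by (rule linear_mapI) (auto intro!: eqI simp: linear_map_add[OF hopf_aut_linear[OF \<theta>]]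
        linear_map_smult[OF hopf_aut_linear[OF \<theta>]])
  have "comult H (?\<gamma> h) = sweedler2 H HH h (\<lambda>a c. pure_tensor K H H (?\<gamma> a) (?\<gamma> c))"
    if h: "h \<in> carrier H" for h
  proof -
    \<comment> \<open>Write h as \<theta> of its preimage: the comultiplication rule for \<theta>
      puts \<theta> on both legs, where the inverse cancels it.\<close>
    have "sweedler2 H HH (\<theta> (?\<gamma> h)) (\<lambda>a c. pure_tensor K H H (?\<gamma> a) (?\<gamma> c))
        = sweedler2 H HH (?\<gamma> h) (\<lambda>a c. pure_tensor K H H (?\<gamma> (\<theta> a)) (?\<gamma> (\<theta> c)))"
      using h \<theta> by (intro sweedler2_hopf_aut) (auto intro!: linear_sweedler linear_map_comp[OF lin])
    also have "\<dots> = sweedler2 H HH (?\<gamma> h) (pure_tensor K H H)"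
      using h by (intro sweedler2_cong) auto
    also have "\<dots> = comult H (?\<gamma> h)"
      using h by (simp add: sweedler2_def HH.tsum_eq_self)
    finally show ?thesis using h by simp
  qed
  moreover have "\<epsilon> (?\<gamma> h) = \<epsilon> h" if "h \<in> carrier H" for h
    using that hopf_aut_counit[OF \<theta>, of "?\<gamma> h"] by simp
  moreover have "?\<gamma> \<in> ring_hom H H"
    using linear_map_add[OF lin]
    by (auto intro!: ring_hom_memI eqI simp: hopf_aut_mult[OF \<theta>] hopf_aut_one[OF \<theta>]
        linear_map_add[OF hopf_aut_linear[OF \<theta>]])
  moreover have "bij_betw ?\<gamma> (carrier H) (carrier H)"
    using \<theta> by (simp add: hopf_aut_def bij_betw_inv_into)
  ultimately show ?thesis using lin by (simp add: hopf_aut_def)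
qed

lemma character_hopf_aut:
  assumes "character K H u" "\<theta> \<in> hopf_aut K H"
  shows "character K H (\<lambda>h. u (\<theta> h))"
  using assms hopf_aut_closed[OF assms(2)] linear_map_smult[OF hopf_aut_linear[OF assms(2)]]
    linear_map_add[OF hopf_aut_linear[OF assms(2)]]
  unfolding character_def[of _ _ "\<lambda>h. u (\<theta> h)"]
  by (auto intro!: ring_hom_memI simp: hopf_aut_mult hopf_aut_one character_add)

text \<open>In \<open>F\<close> the character is u = f \<beta>^-1 S; this slides its translation
  through \<beta> and leaves one by f S.\<close>

lemma left_hit_hopf_aut:
  assumes u: "character K H u" and \<theta>: "\<theta> \<in> hopf_aut K H" and h: "h \<in> carrier H"
  shows "left_hit u (\<theta> h) = \<theta> (left_hit (\<lambda>x. u (\<theta> x)) h)"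
proof -
  note [simp] = hopf_aut_closed[OF \<theta>]
  have "left_hit u (\<theta> h) = sweedler2 H H h (\<lambda>a c. u (\<theta> a) \<odot> \<theta> c)"
    unfolding left_hit_def using u \<theta> h
    by (intro sweedler2_hopf_aut) (auto intro!: linear_sweedler linear_character[where u=u])
  then show ?thesis
    using u h by (simp add: left_hit_def linear_map_sweedler2[OF hopf_aut_linear[OF \<theta>]]
        linear_map_smult[OF hopf_aut_linear[OF \<theta>]] cong: sweedler2_cong)
qed

lemma right_hit_hopf_aut:
  assumes u: "character K H u" and \<theta>: "\<theta> \<in> hopf_aut K H" and h: "h \<in> carrier H"
  shows "right_hit u (\<theta> h) = \<theta> (right_hit (\<lambda>x. u (\<theta> x)) h)"
proof -
  note [simp] = hopf_aut_closed[OF \<theta>]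
  have "right_hit u (\<theta> h) = sweedler2 H H h (\<lambda>a c. u (\<theta> c) \<odot> \<theta> a)"
    unfolding right_hit_def using u \<theta> h
    by (intro sweedler2_hopf_aut) (auto intro!: linear_sweedler linear_character[where u=u])
  then show ?thesis
    using u h by (simp add: right_hit_def linear_map_sweedler2[OF hopf_aut_linear[OF \<theta>]]
        linear_map_smult[OF hopf_aut_linear[OF \<theta>]] cong: sweedler2_cong)
qed

section \<open>Group-like elements\<close>

lemma group_like_closed: "group_like K H g \<Longrightarrow> g \<in> carrier H"
  by (simp add: group_like_def)

lemma sweedler2_group_like:
  assumes "module K X" "bilinear_map K H H X b" "group_like K H g"
  shows "sweedler2 H X g b = b g g"
  using assms by (simp add: sweedler2_def group_like_def HH.tsum_pure_tensor)

lemma group_like_inverse: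
  assumes g: "group_like K H g"
  shows "S g \<otimes> g = \<one>" "g \<otimes> S g = \<one>"
proof -
  have gc: "g \<in> carrier H" and g1: "\<epsilon> g = \<one>\<^bsub>K\<^esub>" using g by (auto simp: group_like_def)
  have "sweedler2 H H g (\<lambda>a c. S a \<otimes> c) = S g \<otimes> g"
    using g by (intro sweedler2_group_like) (auto intro!: linear_sweedler)
  then show "S g \<otimes> g = \<one>" using gc g1 by (simp add: antipode_left)
  have "sweedler2 H H g (\<lambda>a c. a \<otimes> S c) = g \<otimes> S g"
    using g by (intro sweedler2_group_like) (auto intro!: linear_sweedler)
  then show "g \<otimes> S g = \<one>" using gc g1 by (simp add: antipode_right)
qed

lemma inv_group_like_eq:
  assumes g: "group_like K H g"
  shows "inv g = S g"
  using group_like_inverse[OF g] group_like_closed[OF g] by (intro H.inv_char) auto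

lemma inv_group_like_simps:
  assumes g: "group_like K H g"
  shows "inv g \<in> carrier H" "inv g \<otimes> g = \<one>" "g \<otimes> inv g = \<one>"
    "x \<in> carrier H \<Longrightarrow> inv g \<otimes> (g \<otimes> x) = x" "x \<in> carrier H \<Longrightarrow> g \<otimes> (inv g \<otimes> x) = x"
    "x \<in> carrier H \<Longrightarrow> x \<otimes> inv g \<otimes> g = x" "x \<in> carrier H \<Longrightarrow> x \<otimes> g \<otimes> inv g = x"
    "inv_antipode g = inv g" "inv_antipode (inv g) = g"
proof -
  note gc [simp] = group_like_closed[OF g]
  note eq = inv_group_like_eq[OF g]
  show 1: "inv g \<in> carrier H" and 2: "inv g \<otimes> g = \<one>" and 3: "g \<otimes> inv g = \<one>"
    using group_like_inverse[OF g] by (auto simp: eq)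
  show "inv g \<otimes> (g \<otimes> x) = x" "g \<otimes> (inv g \<otimes> x) = x" "x \<otimes> inv g \<otimes> g = x" "x \<otimes> g \<otimes> inv g = x"
    if "x \<in> carrier H"
    using that 1 2 3 by (simp_all add: H.m_assoc[symmetric]) (simp_all add: H.m_assoc)
  show 4: "inv_antipode (inv g) = g" by (simp add: eq)
  \<comment> \<open>S^-1 sends g^-1 = S(g) to g; since it reverses products, it turns g^-1 g = 1
    into S^-1(g) g = 1.\<close>
  have "inv_antipode (inv g \<otimes> g) = inv_antipode g \<otimes> g"
    using 1 4 by (simp add: inv_antipode_mult)
  moreover have "inv_antipode \<one> = \<one>" by (rule inv_antipode_eqI) (auto simp: antipode_one)
  ultimately have "inv_antipode g \<otimes> g = \<one>" using 2 by simp
  then have "inv_antipode g \<otimes> g \<otimes> inv g = inv g" using 1 by simp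
  then show "inv_antipode g = inv g" using 1 3 by (simp add: H.m_assoc)
qed

lemma group_like_inv:
  assumes g: "group_like K H g"
  shows "group_like K H (inv g)"
proof -
  note [simp] = group_like_closed[OF g] inv_group_like_simps[OF g]
  \<comment> \<open>\<open>?b\<close> multiplies both legs by g^-1. Evaluated at g g^-1 = 1 it has
    two readings: by multiplicativity the comultiplication of g^-1, and by the rule for the unit the
    tensor of g^-1 with itself.\<close>
  let ?b = "\<lambda>a c. pure_tensor K H H (inv g \<otimes> a) (inv g \<otimes> c)"
  have b: "bilinear_map K H H HH ?b" by (auto intro!: linear_sweedler)
  have "sweedler2 H HH (g \<otimes> inv g) ?b
      = sweedler2 H HH g (\<lambda>a c. sweedler2 H HH (inv g) (\<lambda>a' c'. ?b (a \<otimes> a') (c \<otimes> c')))"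
    by (rule sweedler2_mult[OF module_HH b]) auto
  also have "\<dots> = sweedler2 H HH (inv g) (\<lambda>a' c'. ?b (g \<otimes> a') (g \<otimes> c'))"
    using g by (intro sweedler2_group_like) (auto intro!: linear_sweedler)
  also have "\<dots> = sweedler2 H HH (inv g) (pure_tensor K H H)"
    by (intro sweedler2_cong) auto
  also have "\<dots> = comult H (inv g)"
    by (simp add: sweedler2_def HH.tsum_eq_self)
  finally have "comult H (inv g) = pure_tensor K H H (inv g) (inv g)"
    using sweedler2_one[OF module_HH b] by simp
  moreover have "\<epsilon> (inv g \<otimes> g) = \<epsilon> (inv g) \<otimes>\<^bsub>K\<^esub> \<epsilon> g"
    by (rule character_mult[OF character_counit]) auto
  then have "\<epsilon> (inv g) = \<one>\<^bsub>K\<^esub>"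
    using g K.r_one[of "\<epsilon> (inv g)"] by (simp add: group_like_def del: K.r_one)
  ultimately show ?thesis by (simp add: group_like_def)
qed

text \<open>
  The pair condition says \<open>\<alpha> h = g\<^sup>-\<^sup>1 \<beta>(\<lambda> (\<rho>' h)) g\<close> for the translations \<open>\<lambda>\<close> and \<open>\<rho>'\<close> by \<open>f\<close> and
  \<open>f S\<close>. These commute, so either of them can be moved to the other side.
\<close>

context
  fixes \<alpha> \<beta> f g
  assumes \<alpha>: "\<alpha> \<in> hopf_aut K H" and \<beta>: "\<beta> \<in> hopf_aut K H"
    and pair: "pair_in_involution K H \<alpha> \<beta> f g"
begin

lemma pair_character: "character K H f"
  using pair by (simp add: pair_in_involution_def)

lemma pair_group_like: "group_like K H g"
  using pair by (simp add: pair_in_involution_def)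

lemma pair_conjugation:
  assumes h: "h \<in> carrier H"
  shows "\<alpha> h = inv g \<otimes> \<beta> (left_hit f (right_hit (\<lambda>x. f (S x)) h)) \<otimes> g"
proof -
  note f = pair_character
  note fS = character_antipode[OF f]
  note [simp] = group_like_closed[OF pair_group_like] inv_group_like_simps[OF pair_group_like]
    hopf_aut_closed[OF \<beta>] f
  \<comment> \<open>Conjugation by g after \<beta> is linear, so it can be pulled out of the
    threefold sum; what remains inside is a twofold translate of \<open>h\<close>.\<close>
  define w where "w x = inv g \<otimes> \<beta> x \<otimes> g" for x
  have w: "linear_map K H H w"
    unfolding w_def by (auto intro!: linear hopf_aut_linear[OF \<beta>])
  have [simp]: "w x \<in> carrier H" if "x \<in> carrier H" for x using that by (rule linear_map_closed[OF w])
  have *: "inv g \<otimes> (f a \<odot> (f (S d) \<odot> \<beta> c)) \<otimes> g = w (f a \<odot> (f (S d) \<odot> c))"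
    if "a \<in> carrier H" "c \<in> carrier H" "d \<in> carrier H" for a c d
    using that by (simp add: w_def linear_map_smult[OF hopf_aut_linear[OF \<beta>]])
  have "\<alpha> h = sweedler2 H H h (\<lambda>a r. sweedler2 H H r (\<lambda>c d. w (f a \<odot> (f (S d) \<odot> c))))"
    using pair h * by (simp add: pair_in_involution_def sweedler3_def cong: sweedler2_cong)
  also have "\<dots> = w (sweedler2 H H h (\<lambda>a r. sweedler2 H H r (\<lambda>c d. f a \<odot> (f (S d) \<odot> c))))"
    using h by (simp add: linear_map_sweedler2[OF w] cong: sweedler2_cong)
  also have "sweedler2 H H h (\<lambda>a r. sweedler2 H H r (\<lambda>c d. f a \<odot> (f (S d) \<odot> c)))
      = sweedler2 H H h (\<lambda>a r. f a \<odot> right_hit (\<lambda>x. f (S x)) r)"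
    unfolding right_hit_def using h
    by (intro sweedler2_cong linear_map_sweedler2[OF linear_map_const_smult[OF linear_map_ident], symmetric]) auto
  also have "\<dots> = right_hit (\<lambda>x. f (S x)) (left_hit f h)"
    using h fS by (simp add: left_hit_def[of f] linear_map_sweedler2[OF linear_right_hit[OF fS]]
        linear_map_smult[OF linear_right_hit[OF fS]] cong: sweedler2_cong)
  finally show ?thesis
    using h by (simp add: left_right_hit_commute[OF f fS] w_def)
qed

text \<open>At \<rho>_f h the right translation in \<open>pair_conjugation\<close> cancels and only
  \<lambda>_f stays. S^-1 reverses the product and inverts \<open>g\<close>, so the conjugating
  factors keep their places. This is the twist condition for \<open>G\<close>.\<close>

lemma pair_inv_antipode_right:
  assumes h: "h \<in> carrier H"
  shows "g \<otimes> \<alpha> (inv_antipode (right_hit f h)) = inv_antipode (\<beta> (left_hit f h)) \<otimes> g"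
proof -
  note f = pair_character
  note fS = character_antipode[OF f]
  note [simp] = group_like_closed[OF pair_group_like] inv_group_like_simps[OF pair_group_like]
    hopf_aut_closed[OF \<beta>] hopf_aut_closed[OF \<alpha>] f
  have "\<alpha> (right_hit f h) = inv g \<otimes> \<beta> (left_hit f h) \<otimes> g"
    using h pair_conjugation[of "right_hit f h"]
      right_hit_inverse[OF f fS convolution_inverse_antipode(2)[OF f] h] by simp
  then have "inv_antipode (\<alpha> (right_hit f h)) = inv g \<otimes> (inv_antipode (\<beta> (left_hit f h)) \<otimes> g)"
    using h by (simp add: inv_antipode_mult)
  then show ?thesis using h by (simp add: hopf_aut_inv_antipode[OF \<alpha>])
qed

text \<open>The mirror case, for \<open>F\<close>: at the left translate by f S, the factor
  \<lambda>_f cancels once it has been moved past the right translation, and the latter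
  stays.\<close>

lemma pair_inv_antipode_left:
  assumes h: "h \<in> carrier H"
  shows "\<alpha> (inv_antipode (left_hit (\<lambda>x. f (S x)) h)) \<otimes> inv g
    = inv g \<otimes> inv_antipode (\<beta> (right_hit (\<lambda>x. f (S x)) h))"
proof -
  note f = pair_character
  note fS = character_antipode[OF f]
  note [simp] = group_like_closed[OF pair_group_like] inv_group_like_simps[OF pair_group_like]
    hopf_aut_closed[OF \<beta>] hopf_aut_closed[OF \<alpha>] f fS
  let ?l = "left_hit (\<lambda>x. f (S x))" and ?r = "right_hit (\<lambda>x. f (S x))"
  have "left_hit f (?r (?l h)) = ?r h"
    using h left_hit_inverse[OF fS f convolution_inverse_antipode(2)[OF f]]
    by (simp add: left_right_hit_commute[OF fS fS, symmetric])
  then have "\<alpha> (?l h) = inv g \<otimes> \<beta> (?r h) \<otimes> g"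
    using h pair_conjugation[of "?l h"] by simp
  then have "inv_antipode (\<alpha> (?l h)) = inv g \<otimes> (inv_antipode (\<beta> (?r h)) \<otimes> g)"
    using h by (simp add: inv_antipode_mult)
  then show ?thesis using h by (simp add: hopf_aut_inv_antipode[OF \<alpha>] H.m_assoc)
qed

end

end

section \<open>Tensor products under a change of action and coaction\<close>

lemma tensor_eq_change_module:
  assumes "carrier V' = carrier V" "zero V' = zero V" "add V' = add V"
    "module.smult V' = module.smult V"
  shows "tensor_eq K V W xs ys \<Longrightarrow> tensor_eq K V' W xs ys"
proof (induction rule: tensor_eq.induct)
  case (refl xs)
  then show ?case using tensor_eq.refl[of xs V' W K] by (simp add: assms)
next
  case (trans xs ys zs)
  then show ?case by (blast intro: tensor_eq.trans)
next
  case (sym xs ys)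
  from sym.IH show ?case by (rule tensor_eq.sym)
next
  case (zero w)
  then show ?case using tensor_eq.zero[of w W K V'] by (simp add: assms)
next
  case (add_left v v' w)
  then show ?case using tensor_eq.add_left[of v V' v' w W K] by (simp add: assms)
next
  case (smult k v w)
  then show ?case using tensor_eq.smult[of k K v V' w W] by (simp add: assms)
qed (auto intro: tensor_eq.intros(4,5,8) simp: assms)

text \<open>The congruence does not mention \<open>act\<close> and \<open>coact\<close>, so a module
  and its twist have literally equal tensor products and their coactions can be compared
  directly.\<close>

lemma tensor_yd_update [simp]:
  "tensor K (M\<lparr>act := a, coact := b\<rparr>) W = tensor K M W"
  "pure_tensor K (M\<lparr>act := a, coact := b\<rparr>) W = pure_tensor K M W"
proof -
  have "tensor_eq K (M\<lparr>act := a, coact := b\<rparr>) W = tensor_eq K M W"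
    by (intro ext iffI; erule tensor_eq_change_module[rotated -1]) auto
  then have "tensor_class K (M\<lparr>act := a, coact := b\<rparr>) W = tensor_class K M W"
    by (simp add: tensor_class_def fun_eq_iff)
  then show "tensor K (M\<lparr>act := a, coact := b\<rparr>) W = tensor K M W"
    "pure_tensor K (M\<lparr>act := a, coact := b\<rparr>) W = pure_tensor K M W"
    by (simp_all add: tensor_def pure_tensor_def fun_eq_iff)
qed

lemma module_yd_update [simp]: "module K (M\<lparr>act := a, coact := b\<rparr>) \<longleftrightarrow> module K M"
  by (simp add: module_def module_axioms_def abelian_group_def abelian_monoid_def
      abelian_group_axioms_def)

lemma linear_map_yd_update [simp]:
  "linear_map K (M\<lparr>act := a, coact := b\<rparr>) W u \<longleftrightarrow> linear_map K M W u"
  "linear_map K V (M\<lparr>act := a, coact := b\<rparr>) u \<longleftrightarrow> linear_map K V M u"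
  by (simp_all add: linear_map_def)

lemma tsum_yd_update [simp]: "tsum (M\<lparr>act := a, coact := b\<rparr>) = tsum M"
  by (simp add: tsum_def fun_eq_iff)

context hopf
begin

section \<open>Threefold Sweedler sums\<close>

lemma sweedler3_left_hit:
  assumes X: "module K X" and c: "trilinear_map K H H H X c" and u: "character K H u"
    and h: "h \<in> carrier H"
  shows "sweedler3 H X (left_hit u h) c = sweedler3 H X h (\<lambda>a. c (left_hit u a))"
proof -
  have "bilinear_map K H H X (\<lambda>a r. sweedler2 H X r (c a))"
    using X c by (auto simp: trilinear_map_def bilinear_map_def intro!: linear_sweedler2 linear_sweedler2_param)
  from sweedler2_left_hit[OF X this u h] show ?thesis by (simp add: sweedler3_def)
qed

lemma sweedler3_hopf_aut:
  assumes X: "module K X" and c: "trilinear_map K H H H X c" and \<theta>: "\<theta> \<in> hopf_aut K H"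
    and h: "h \<in> carrier H"
  shows "sweedler3 H X (\<theta> h) c = sweedler3 H X h (\<lambda>x y z. c (\<theta> x) (\<theta> y) (\<theta> z))"
proof -
  have b: "bilinear_map K H H X (\<lambda>a r. sweedler2 H X r (c a))"
    using X c by (auto simp: trilinear_map_def bilinear_map_def intro!: linear_sweedler2 linear_sweedler2_param)
  have "sweedler3 H X (\<theta> h) c = sweedler2 H X h (\<lambda>a r. sweedler2 H X (\<theta> r) (c (\<theta> a)))"
    using sweedler2_hopf_aut[OF X b \<theta> h] by (simp add: sweedler3_def)
  also have "\<dots> = sweedler3 H X h (\<lambda>x y z. c (\<theta> x) (\<theta> y) (\<theta> z))"
    unfolding sweedler3_def using X c \<theta> h hopf_aut_closed[OF \<theta>]
    by (intro sweedler2_cong sweedler2_hopf_aut) (auto simp: trilinear_map_def)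
  finally show ?thesis .
qed

lemma sweedler3_cong:
  assumes "h \<in> carrier H"
    and "\<And>x y z. x \<in> carrier H \<Longrightarrow> y \<in> carrier H \<Longrightarrow> z \<in> carrier H \<Longrightarrow> c x y z = c' x y z"
  shows "sweedler3 H X h c = sweedler3 H X h c'"
  unfolding sweedler3_def using assms by (intro sweedler2_cong) auto

text \<open>\<rho>_u on the first leg becomes \<lambda>_u on the undivided rest, and comultiplying a
  left translate keeps \<lambda>_u on its first leg, which is the second leg of h.\<close>

lemma sweedler3_right_hit:
  assumes X: "module K X" and c: "trilinear_map K H H H X c" and u: "character K H u"
    and h: "h \<in> carrier H"
  shows "sweedler3 H X h (\<lambda>a. c (right_hit u a)) = sweedler3 H X h (\<lambda>a b. c a (left_hit u b))"
proof -
  have b: "bilinear_map K H H X (\<lambda>a r. sweedler2 H X r (c a))"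
    using X c by (auto simp: trilinear_map_def bilinear_map_def intro!: linear_sweedler2 linear_sweedler2_param)
  have "sweedler3 H X h (\<lambda>a. c (right_hit u a)) = sweedler2 H X h (\<lambda>a r. sweedler2 H X (left_hit u r) (c a))"
    using sweedler2_right_hit_left[OF X b u h] by (simp add: sweedler3_def)
  also have "\<dots> = sweedler3 H X h (\<lambda>a b. c a (left_hit u b))"
    unfolding sweedler3_def using X c u h
    by (intro sweedler2_cong sweedler2_left_hit) (auto simp: trilinear_map_def)
  finally show ?thesis .
qed

lemma linear_map_sweedler3:
  assumes "linear_map K X Y u" "module K X" "module K Y" "h \<in> carrier H"
    and "\<And>a b c. a \<in> carrier H \<Longrightarrow> b \<in> carrier H \<Longrightarrow> c \<in> carrier H \<Longrightarrow> t a b c \<in> carrier X"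
  shows "u (sweedler3 H X h t) = sweedler3 H Y h (\<lambda>a b c. u (t a b c))"
  unfolding sweedler3_def using assms
  by (simp add: linear_map_sweedler2[OF assms(1)] cong: sweedler2_cong)

end


section \<open>Twisting Yetter--Drinfeld modules\<close>

text \<open>The Yetter-Drinfeld equation is left out because it depends on (\<alpha>, \<beta>),
  while the module and comodule parts of a twist do not.\<close>

locale hopf_module = hopf K H for K :: "('k, 'r) ring_scheme" and H :: "('k, 'h, 's) hopf_scheme" (structure) +
  fixes M :: "('k, 'h, 'm) yd"
  assumes left_module: "left_module K H M" and right_comodule: "right_comodule K H M"

sublocale hopf_module \<subseteq> MH: two_modules K M H
  using left_module by (simp add: two_modules_def left_module_def)

context hopf_module
begin

abbreviation "MH \<equiv> tensor K M H"

lemma module_M [simp]: "module K M" by (rule MH.V.module_axioms)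

lemma module_MH [simp]: "module K MH" by (rule MH.tensor_module)

lemma linear_act: "h \<in> carrier H \<Longrightarrow> linear_map K M M (act M h)"
  using left_module by (simp add: left_module_def)

lemma linear_act_left: "m \<in> carrier M \<Longrightarrow> linear_map K H M (\<lambda>h. act M h m)"
  using left_module by (simp add: left_module_def)

lemma act_closed [simp]: "h \<in> carrier H \<Longrightarrow> m \<in> carrier M \<Longrightarrow> act M h m \<in> carrier M"
  by (rule linear_map_closed[OF linear_act])

lemma act_one: "m \<in> carrier M \<Longrightarrow> act M \<one> m = m"
  using left_module by (simp add: left_module_def)

lemma act_mult:
  "h \<in> carrier H \<Longrightarrow> h' \<in> carrier H \<Longrightarrow> m \<in> carrier M \<Longrightarrow> act M (h \<otimes> h') m = act M h (act M h' m)"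
  using left_module by (simp add: left_module_def)

lemma linear_coact: "linear_map K M MH (coact M)"
  using right_comodule by (simp add: right_comodule_def Let_def)

lemma coact_closed [simp]: "m \<in> carrier M \<Longrightarrow> coact M m \<in> carrier MH"
  by (rule linear_map_closed[OF linear_coact])

lemma coact_counit:
  "m \<in> carrier M \<Longrightarrow> tsum M (coact M m) (\<lambda>m0 m1. \<epsilon> m1 \<odot>\<^bsub>M\<^esub> m0) = m"
  using right_comodule by (simp add: right_comodule_def Let_def)

lemma tsum_coact_closed [simp]:
  assumes "module K X" "m \<in> carrier M"
    and "\<And>n h. n \<in> carrier M \<Longrightarrow> h \<in> carrier H \<Longrightarrow> b n h \<in> carrier X"
  shows "tsum X (coact M m) b \<in> carrier X"
proof -
  interpret X: module K X by fact
  show ?thesis using assms by (intro MH.tsum_closed X.abelian_monoid_axioms) auto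
qed

lemma tsum_coact_cong:
  assumes "m \<in> carrier M"
    and "\<And>n h. n \<in> carrier M \<Longrightarrow> h \<in> carrier H \<Longrightarrow> b n h = b' n h"
  shows "tsum X (coact M m) b = tsum X (coact M m) b'"
  using assms by (intro MH.tsum_cong) auto

text \<open>As for \<open>coassoc\<close>: the axiom is mapped along the linear map that the
  trilinear map induces on M tensor (H tensor H).\<close>

lemma coact_coassoc:
  assumes X: "module K X" and c: "trilinear_map K M H H X c" and m: "m \<in> carrier M"
  shows "tsum X (coact M m) (\<lambda>m0 m1. tsum X (coact M m0) (\<lambda>n0 n1. c n0 n1 m1))
    = tsum X (coact M m) (\<lambda>m0 m1. sweedler2 H X m1 (c m0))"
proof -
  interpret MHH: two_modules K M HH by (simp add: two_modules_def)
  let ?T = "tensor K M HH"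
  define \<phi> where "\<phi> t = tsum X t (\<lambda>x s. tsum X s (c x))" for t
  have T: "module K ?T" by (rule MHH.tensor_module)
  have bil: "bilinear_map K M HH X (\<lambda>x s. tsum X s (c x))"
    using X c by (intro HH.bilinear_tsum) auto
  have bc: "bilinear_map K H H X (c x)" if "x \<in> carrier M" for x
    using c that by (auto simp: trilinear_map_def)
  have \<phi>: "linear_map K ?T X \<phi>" unfolding \<phi>_def by (rule MHH.linear_tsum[OF X bil])
  have pure: "\<phi> (pure_tensor K M HH x s) = tsum X s (c x)" if "x \<in> carrier M" "s \<in> carrier HH" for x s
    unfolding \<phi>_def using that by (rule MHH.tsum_pure_tensor[OF X bil])
  have "\<phi> (tsum ?T (coact M m) (\<lambda>m0 m1. tsum ?T (coact M m0)
         (\<lambda>n0 n1. pure_tensor K M HH n0 (pure_tensor K H H n1 m1)))) =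
       \<phi> (tsum ?T (coact M m) (\<lambda>m0 m1. pure_tensor K M HH m0 (comult H m1)))"
    using right_comodule m by (simp add: right_comodule_def Let_def)
  moreover have "\<phi> (tsum ?T (coact M m) (\<lambda>m0 m1. pure_tensor K M HH m0 (comult H m1)))
      = tsum X (coact M m) (\<lambda>m0 m1. sweedler2 H X m1 (c m0))"
    using m X T by (subst MH.linear_map_tsum[OF \<phi>])
      (auto simp: pure sweedler2_def MHH.pure_tensor_closed intro!: tsum_coact_cong)
  moreover have "\<phi> (tsum ?T (coact M m) (\<lambda>m0 m1. tsum ?T (coact M m0)
         (\<lambda>n0 n1. pure_tensor K M HH n0 (pure_tensor K H H n1 m1))))
      = tsum X (coact M m) (\<lambda>m0 m1. tsum X (coact M m0) (\<lambda>n0 n1. c n0 n1 m1))"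
    using m X T by (simp add: MH.linear_map_tsum[OF \<phi>] MHH.pure_tensor_closed
        HH.pure_tensor_closed pure HH.tsum_pure_tensor bc cong: tsum_coact_cong)
  ultimately show ?thesis by simp
qed

end

text \<open>The branch \<open>undefined\<close> and the restricted lambda keep twists of a
  \<open>normalized\<close> module normalized, so that they are objects of
  \<open>YD\<close>.\<close>

definition (in hopf) twist :: "('h \<Rightarrow> 'h) \<Rightarrow> ('h \<Rightarrow> 'k) \<Rightarrow> 'h \<Rightarrow> ('k, 'h, 'm) yd \<Rightarrow> ('k, 'h, 'm) yd"
  where "twist \<theta> u c M = M
    \<lparr>act := (\<lambda>h m. if h \<in> carrier H \<and> m \<in> carrier M
       then act M (\<theta> (left_hit u h)) m else undefined),
     coact := (\<lambda>m\<in>carrier M. tsum (tensor K M H) (coact M m)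
       (\<lambda>m0 m1. pure_tensor K M H m0 (m1 \<otimes> c)))\<rparr>"

lemma (in hopf) twist_simps [simp]:
  "carrier (twist \<theta> u c M) = carrier M"
  "tensor K (twist \<theta> u c M) W = tensor K M W"
  "pure_tensor K (twist \<theta> u c M) W = pure_tensor K M W"
  "module K (twist \<theta> u c M) \<longleftrightarrow> module K M"
  "linear_map K (twist \<theta> u c M) W' w \<longleftrightarrow> linear_map K M W' w"
  "linear_map K V (twist \<theta> u c M) w' \<longleftrightarrow> linear_map K V M w'"
  "tsum (twist \<theta> u c M) = tsum M"
  "smult (twist \<theta> u c M) = smult M"
  "h \<in> carrier H \<Longrightarrow> m \<in> carrier M \<Longrightarrow> act (twist \<theta> u c M) h m = act M (\<theta> (left_hit u h)) m"
  "m \<in> carrier M \<Longrightarrow> coact (twist \<theta> u c M) m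
    = tsum (tensor K M H) (coact M m) (\<lambda>m0 m1. pure_tensor K M H m0 (m1 \<otimes> c))"
  by (simp_all add: twist_def linear_map_def)

lemma (in hopf) normalized_twist: "normalized K H M \<Longrightarrow> normalized K H (twist \<theta> u c M)"
  by (auto simp: normalized_def twist_def)

locale twisting = hopf_module K H M
  for K :: "('k, 'r) ring_scheme" and H :: "('k, 'h, 's) hopf_scheme" (structure)
    and M :: "('k, 'h, 'm) yd" +
  fixes \<theta> u c
  assumes \<theta>: "\<theta> \<in> hopf_aut K H" and u: "character K H u" and c: "group_like K H c"
begin

lemma c_closed [simp]: "c \<in> carrier H" by (rule group_like_closed[OF c])

lemma \<theta>_closed [simp]: "h \<in> carrier H \<Longrightarrow> \<theta> h \<in> carrier H" by (rule hopf_aut_closed[OF \<theta>])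

declare u [simp]

text \<open>The identity tensor right multiplication by \<open>c\<close>, as a map on tensors: the
  new coaction is its composite with the old one, and linearity carries it through sums.\<close>

definition shift :: "('m, 'h) tensor \<Rightarrow> ('m, 'h) tensor"
  where "shift t = tsum MH t (\<lambda>m0 m1. pure_tensor K M H m0 (m1 \<otimes> c))"

lemma bilinear_shift: "bilinear_map K M H MH (\<lambda>m0 m1. pure_tensor K M H m0 (m1 \<otimes> c))"
  by (auto intro!: bilinear_mapI linear)

lemma linear_shift: "linear_map K MH MH shift"
  unfolding shift_def by (rule MH.linear_tsum[OF module_MH bilinear_shift])

lemma shift_pure:
  "m \<in> carrier M \<Longrightarrow> h \<in> carrier H \<Longrightarrow> shift (pure_tensor K M H m h) = pure_tensor K M H m (h \<otimes> c)"
  unfolding shift_def by (rule MH.tsum_pure_tensor[OF module_MH bilinear_shift])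

lemma coact_twist: "m \<in> carrier M \<Longrightarrow> coact (twist \<theta> u c M) m = shift (coact M m)"
  by (simp add: shift_def)

lemma tsum_coact_twist:
  assumes X: "module K X" and b: "bilinear_map K M H X b" and m: "m \<in> carrier M"
  shows "tsum X (coact (twist \<theta> u c M) m) b = tsum X (coact M m) (\<lambda>m0 m1. b m0 (m1 \<otimes> c))"
proof -
  have "tsum X (coact (twist \<theta> u c M) m) b
      = tsum X (coact M m) (\<lambda>m0 m1. tsum X (pure_tensor K M H m0 (m1 \<otimes> c)) b)"
    using m X by (simp add: MH.linear_map_tsum[OF MH.linear_tsum[OF X b]] MH.pure_tensor_closed)
  also have "\<dots> = tsum X (coact M m) (\<lambda>m0 m1. b m0 (m1 \<otimes> c))"
    using m by (intro tsum_coact_cong MH.tsum_pure_tensor[OF X b]) auto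
  finally show ?thesis .
qed

lemma left_module_twist: "left_module K H (twist \<theta> u c M)"
proof -
  have lin: "linear_map K H M (\<lambda>h. act M (\<theta> (left_hit u h)) m)" if "m \<in> carrier M" for m
    using that by (intro linear_map_comp[OF linear_act_left] linear_map_comp[OF hopf_aut_linear[OF \<theta>]]
        linear_left_hit) auto
  have "linear_map K M M (act (twist \<theta> u c M) h)" if "h \<in> carrier H" for h
    using that linear_act[of "\<theta> (left_hit u h)"]
    by (subst linear_map_cong[where v="act M (\<theta> (left_hit u h))"]) auto
  moreover have "linear_map K H M (\<lambda>h. act (twist \<theta> u c M) h m)" if "m \<in> carrier M" for m
    using that lin[OF that]
    by (subst linear_map_cong[where v="\<lambda>h. act M (\<theta> (left_hit u h)) m"]) auto
  ultimately show ?thesis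
    by (auto simp: left_module_def left_hit_one left_hit_mult hopf_aut_one[OF \<theta>] hopf_aut_mult[OF \<theta>]
        act_one act_mult)
qed

text \<open>Since \<open>c\<close> is group-like, the comultiplication of a c is a1 c tensor a2 c,
  and a c has the counit of a; both comodule axioms then follow from those of
  \<open>M\<close>.\<close>

lemma right_comodule_twist: "right_comodule K H (twist \<theta> u c M)"
proof -
  interpret MHH: two_modules K M HH by (simp add: two_modules_def)
  let ?T = "tensor K M HH" and ?N = "twist \<theta> u c M"
  have T [simp]: "module K ?T" by (rule MHH.tensor_module)
  have lin: "linear_map K M MH (coact ?N)"
    using linear_map_comp[OF linear_shift linear_coact]
    by (subst linear_map_cong[where v="\<lambda>m. shift (coact M m)"]) (auto simp: coact_twist simp del: twist_simps)
  have lincomult: "linear_map K U HH (\<lambda>x. comult H (w x))" if "linear_map K U H w" for U :: "('k, 'a, 'b) module_scheme" and w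
    by (rule linear_map_comp[OF linear_comult that])
  have coassoc: "tsum ?T (coact ?N m) (\<lambda>m0 m1. tsum ?T (coact ?N m0)
         (\<lambda>n0 n1. pure_tensor K M HH n0 (pure_tensor K H H n1 m1))) =
       tsum ?T (coact ?N m) (\<lambda>m0 m1. pure_tensor K M HH m0 (comult H m1))"
    if m: "m \<in> carrier M" for m
  proof -
    \<comment> \<open>The summand that both sides reach: one factor \<open>c\<close> from each of
      the two nested coactions, or both factors from comultiplying a product with
      \<open>c\<close>.\<close>
    let ?c = "\<lambda>n a b. pure_tensor K M HH n (pure_tensor K H H (a \<otimes> c) (b \<otimes> c))"
    have pp: "bilinear_map K M H ?T (\<lambda>n0 n1. pure_tensor K M HH n0 (pure_tensor K H H n1 m1))"
      if "m1 \<in> carrier H" for m1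
      using that by (auto intro!: bilinear_mapI linear HH.pure_tensor_closed)
    have inner: "tsum ?T (coact ?N m0) (\<lambda>n0 n1. pure_tensor K M HH n0 (pure_tensor K H H n1 m1))
        = tsum ?T (coact M m0) (\<lambda>n0 n1. pure_tensor K M HH n0 (pure_tensor K H H (n1 \<otimes> c) m1))"
      if "m0 \<in> carrier M" "m1 \<in> carrier H" for m0 m1
      using tsum_coact_twist[OF T pp that(1)] that by simp
    \<comment> \<open>The inner sum has to be bilinear in the outer legs before
      \<open>tsum_coact_twist\<close> applies to the outer coaction.\<close>
    have tri: "bilinear_map K M H ?T (\<lambda>m0 m1. tsum ?T (coact ?N m0)
         (\<lambda>n0 n1. pure_tensor K M HH n0 (pure_tensor K H H n1 m1)))"
    proof (rule bilinear_mapI)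
      fix v assume "v \<in> carrier M"
      then show "linear_map K H ?T (\<lambda>m1. tsum ?T (coact ?N v)
         (\<lambda>n0 n1. pure_tensor K M HH n0 (pure_tensor K H H n1 m1)))"
        using linear_map_closed[OF lin] by (intro MH.linear_tsum_param) (auto intro!: linear simp del: twist_simps)
    next
      fix w assume "w \<in> carrier H"
      then show "linear_map K M ?T (\<lambda>m0. tsum ?T (coact ?N m0)
         (\<lambda>n0 n1. pure_tensor K M HH n0 (pure_tensor K H H n1 w)))"
        by (intro linear_map_comp[OF MH.linear_tsum lin] pp) auto
    qed
    have "tsum ?T (coact ?N m) (\<lambda>m0 m1. tsum ?T (coact ?N m0)
         (\<lambda>n0 n1. pure_tensor K M HH n0 (pure_tensor K H H n1 m1)))
       = tsum ?T (coact M m) (\<lambda>m0 m1. tsum ?T (coact ?N m0)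
         (\<lambda>n0 n1. pure_tensor K M HH n0 (pure_tensor K H H n1 (m1 \<otimes> c))))"
      by (rule tsum_coact_twist[OF T tri m])
    also have "\<dots> = tsum ?T (coact M m) (\<lambda>m0 m1. tsum ?T (coact M m0) (\<lambda>n0 n1. ?c n0 n1 m1))"
      using m inner by (intro tsum_coact_cong) auto
    also have "\<dots> = tsum ?T (coact M m) (\<lambda>m0 m1. sweedler2 H ?T m1 (?c m0))"
      using m by (intro coact_coassoc) (auto intro!: trilinear_mapI linear HH.pure_tensor_closed)
    also have "\<dots> = tsum ?T (coact M m) (\<lambda>m0 m1. pure_tensor K M HH m0 (comult H (m1 \<otimes> c)))"
    proof (intro tsum_coact_cong m)
      fix n h assume n: "n \<in> carrier M" and h: "h \<in> carrier H"
      have "comult H (h \<otimes> c) = sweedler2 H HH (h \<otimes> c) (pure_tensor K H H)"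
        using h by (simp add: sweedler2_def HH.tsum_eq_self)
      also have "\<dots> = sweedler2 H HH h (\<lambda>a b. sweedler2 H HH c (\<lambda>a' b'. pure_tensor K H H (a \<otimes> a') (b \<otimes> b')))"
        using h by (intro sweedler2_mult HH.bilinear_pure_tensor) auto
      also have "\<dots> = sweedler2 H HH h (\<lambda>a b. pure_tensor K H H (a \<otimes> c) (b \<otimes> c))"
        using h by (intro sweedler2_cong sweedler2_group_like[OF _ _ c]) (auto intro!: linear_sweedler)
      finally show "sweedler2 H ?T h (?c n) = pure_tensor K M HH n (comult H (h \<otimes> c))"
        using n h by (simp add: linear_map_sweedler2[OF linear_pure_right[OF linear_map_ident module_M module_HH n]]
            HH.pure_tensor_closed)
    qed
    also have "\<dots> = tsum ?T (coact ?N m) (\<lambda>m0 m1. pure_tensor K M HH m0 (comult H m1))"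
      using m by (intro tsum_coact_twist[symmetric]) (auto intro!: bilinear_mapI linear lincomult)
    finally show ?thesis .
  qed
  have "tsum M (coact ?N m) (\<lambda>m0 m1. \<epsilon> m1 \<odot>\<^bsub>M\<^esub> m0) = m" if m: "m \<in> carrier M" for m
  proof -
    have "tsum M (coact ?N m) (\<lambda>m0 m1. \<epsilon> m1 \<odot>\<^bsub>M\<^esub> m0)
        = tsum M (coact M m) (\<lambda>m0 m1. \<epsilon> (m1 \<otimes> c) \<odot>\<^bsub>M\<^esub> m0)"
      using m by (intro tsum_coact_twist) (auto intro!: bilinear_mapI linear)
    also have "\<dots> = tsum M (coact M m) (\<lambda>m0 m1. \<epsilon> m1 \<odot>\<^bsub>M\<^esub> m0)"
      using m c by (intro tsum_coact_cong) (auto simp: group_like_def)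
    finally show ?thesis using m by (simp add: coact_counit)
  qed
  with lin coassoc show ?thesis
    by (simp add: right_comodule_def Let_def del: twist_simps(10))
qed

lemma yd_module_twist:
  assumes yd: "yd_module K H \<alpha> \<beta> M"
    and \<alpha>: "\<alpha> \<in> hopf_aut K H" and \<beta>: "\<beta> \<in> hopf_aut K H"
    and \<alpha>': "\<alpha>' \<in> hopf_aut K H" and \<beta>': "\<beta>' \<in> hopf_aut K H"
    and \<beta>\<theta>: "\<And>h. h \<in> carrier H \<Longrightarrow> \<beta> (\<theta> h) = \<beta>' h"
    and key: "\<And>h. h \<in> carrier H \<Longrightarrow>
      \<alpha> (inv_antipode (\<theta> (left_hit u h))) \<otimes> c = c \<otimes> \<alpha>' (inv_antipode (right_hit u h))"
  shows "yd_module K H \<alpha>' \<beta>' (twist \<theta> u c M)"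
proof -
  let ?N = "twist \<theta> u c M" and ?p = "pure_tensor K M H"
  note [simp] = hopf_aut_closed[OF \<alpha>] hopf_aut_closed[OF \<beta>] hopf_aut_closed[OF \<alpha>'] hopf_aut_closed[OF \<beta>']
    MH.pure_tensor_closed
  note lins = linear linear_map_comp[OF linear_act_left] linear_map_comp[OF hopf_aut_linear[OF \<theta>]]
    linear_map_comp[OF hopf_aut_linear[OF \<alpha>]] linear_map_comp[OF hopf_aut_linear[OF \<beta>]]
    linear_map_comp[OF hopf_aut_linear[OF \<alpha>']] linear_map_comp[OF hopf_aut_linear[OF \<beta>']]
    linear_map_comp[OF linear_inv_antipode] trilinear_mapI MH.linear_tsum_param
  have "coact ?N (act ?N h m) = sweedler3 H MH h (\<lambda>h1 h2 h3.
      tsum MH (coact ?N m) (\<lambda>m0 m1. ?p (act ?N h2 m0) (\<beta>' h3 \<otimes> m1 \<otimes> \<alpha>' (inv_antipode h1))))"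
    if h: "h \<in> carrier H" and m: "m \<in> carrier M" for h m
  proof -
    let ?k = "\<theta> (left_hit u h)"
    \<comment> \<open>\<open>D\<close> is the old compatibility formula with the coaction multiplied
      by \<open>c\<close>; \<open>E\<close> is its form after \<open>c\<close> has crossed the
      factor with S^-1 and \<theta> has been put in. Naming them lets trilinearity be proved
      once.\<close>
    define D where "D k1 k2 k3 = tsum MH (coact M m)
      (\<lambda>m0 m1. ?p (act M k2 m0) (\<beta> k3 \<otimes> m1 \<otimes> \<alpha> (inv_antipode k1) \<otimes> c))" for k1 k2 k3
    define E where "E h1 h2 h3 = tsum MH (coact M m)
      (\<lambda>m0 m1. ?p (act M (\<theta> h2) m0) (\<beta>' h3 \<otimes> m1 \<otimes> (c \<otimes> \<alpha>' (inv_antipode h1))))" for h1 h2 h3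
    have D: "trilinear_map K H H H MH D"
      unfolding D_def using m by (auto intro!: lins)
    have E: "trilinear_map K H H H MH E"
      unfolding E_def using m by (auto intro!: lins)
    have "coact ?N (act ?N h m) = shift (coact M (act M ?k m))"
      using h m by (simp add: shift_def)
    also have "coact M (act M ?k m) = sweedler3 H MH ?k (\<lambda>k1 k2 k3.
        tsum MH (coact M m) (\<lambda>m0 m1. ?p (act M k2 m0) (\<beta> k3 \<otimes> m1 \<otimes> \<alpha> (inv_antipode k1))))"
      using yd h m by (simp add: yd_module_def inv_antipode_def)
    also have "shift \<dots> = sweedler3 H MH ?k (\<lambda>k1 k2 k3. shift
        (tsum MH (coact M m) (\<lambda>m0 m1. ?p (act M k2 m0) (\<beta> k3 \<otimes> m1 \<otimes> \<alpha> (inv_antipode k1)))))"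
      using h m by (intro linear_map_sweedler3[OF linear_shift]) auto
    also have "\<dots> = sweedler3 H MH ?k D"
      unfolding D_def using h m
      by (intro sweedler3_cong) (simp_all add: MH.linear_map_tsum[OF linear_shift] shift_pure cong: tsum_coact_cong)
    also have "\<dots> = sweedler3 H MH (left_hit u h) (\<lambda>x y z. D (\<theta> x) (\<theta> y) (\<theta> z))"
      using h by (intro sweedler3_hopf_aut[OF _ D \<theta>]) auto
    also have "\<dots> = sweedler3 H MH h (\<lambda>x y z. D (\<theta> (left_hit u x)) (\<theta> y) (\<theta> z))"
      using h m unfolding D_def by (intro sweedler3_left_hit) (auto intro!: lins)
    \<comment> \<open>\<open>key\<close> carries \<open>c\<close> across and turns the left
      translate in the first leg into a right one; \<beta> \<theta> becomes \<beta>'.\<close>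
    also have "\<dots> = sweedler3 H MH h (\<lambda>x. E (right_hit u x))"
      unfolding D_def E_def using h m key
      by (intro sweedler3_cong tsum_coact_cong) (simp_all add: H.m_assoc \<beta>\<theta>)
    \<comment> \<open>The translation passes to the second leg, where the twisted action has
      it.\<close>
    also have "\<dots> = sweedler3 H MH h (\<lambda>x y. E x (left_hit u y))"
      using h by (intro sweedler3_right_hit[OF _ E]) auto
    also have "\<dots> = sweedler3 H MH h (\<lambda>h1 h2 h3.
      tsum MH (coact ?N m) (\<lambda>m0 m1. ?p (act ?N h2 m0) (\<beta>' h3 \<otimes> m1 \<otimes> \<alpha>' (inv_antipode h1))))"
    proof (intro sweedler3_cong h)
      fix x y z assume x: "x \<in> carrier H" and y: "y \<in> carrier H" and z: "z \<in> carrier H"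
      let ?b = "\<lambda>m0 m1. ?p (act M (\<theta> (left_hit u y)) m0) (\<beta>' z \<otimes> m1 \<otimes> \<alpha>' (inv_antipode x))"
      have Nm: "coact ?N m \<in> carrier MH"
        using m linear_map_closed[OF linear_shift] by (simp add: coact_twist del: twist_simps)
      have "tsum MH (coact ?N m) (\<lambda>m0 m1. ?p (act ?N y m0) (\<beta>' z \<otimes> m1 \<otimes> \<alpha>' (inv_antipode x)))
          = tsum MH (coact ?N m) ?b"
        using Nm y by (intro MH.tsum_cong) auto
      \<comment> \<open>The remaining \<open>c\<close> stands directly right of \<open>m1\<close>
        and is the contribution of the twisted coaction.\<close>
      also have "\<dots> = tsum MH (coact M m) (\<lambda>m0 m1. ?b m0 (m1 \<otimes> c))"
        using m x y z by (intro tsum_coact_twist) (auto intro!: bilinear_mapI linear linear_act)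
      also have "\<dots> = E x (left_hit u y) z"
        unfolding E_def using m x y z by (intro tsum_coact_cong) (auto simp: H.m_assoc)
      finally show "E x (left_hit u y) z = tsum MH (coact ?N m)
          (\<lambda>m0 m1. ?p (act ?N y m0) (\<beta>' z \<otimes> m1 \<otimes> \<alpha>' (inv_antipode x)))" by simp
    qed
    finally show ?thesis .
  qed
  then show ?thesis
    using left_module_twist right_comodule_twist
    by (simp add: yd_module_def inv_antipode_def del: twist_simps(9,10))
qed

end

context hopf
begin

section \<open>The functors as twists\<close>

lemma hopf_module_yd: "yd_module K H \<alpha> \<beta> M \<Longrightarrow> hopf_module K H M"
  by (simp add: yd_module_def hopf_module_def hopf_module_axioms_def hopf_axioms)

text \<open>The action is linear in H, so the sum and its scalars may be taken inside it; this
  brings the formulas for \<open>F\<close> and \<open>G\<close> to the form of a twist.\<close>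

lemma act_hit:
  assumes M: "yd_module K H \<alpha> \<beta> M" and \<theta>: "\<theta> \<in> hopf_aut K H" and u: "character K H u"
    and h: "h \<in> carrier H" and m: "m \<in> carrier M"
  shows "sweedler2 H M h (\<lambda>a c. u a \<odot>\<^bsub>M\<^esub> act M (\<theta> c) m) = act M (\<theta> (left_hit u h)) m"
proof -
  interpret hopf_module K H M using M by (rule hopf_module_yd)
  note lin = linear_map_comp[OF linear_act_left[OF m] hopf_aut_linear[OF \<theta>]]
  show ?thesis
    unfolding left_hit_def using u h
    by (subst linear_map_sweedler2[OF lin])
      (auto intro!: sweedler2_cong simp: linear_map_smult[OF lin])
qed

lemma G_obj_twist:
  assumes M: "yd_module K H \<alpha> \<beta> M" and \<theta>: "\<theta> \<in> hopf_aut K H" and u: "character K H u"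
  shows "G_obj K H \<theta> u c M = twist \<theta> u c M"
  unfolding G_obj_def twist_def
  by (simp add: act_hit[OF M \<theta> u] cong: if_cong)

lemma F_obj_twist:
  assumes M: "yd_module K H \<alpha> \<beta> M" and \<theta>: "\<theta> \<in> hopf_aut K H" and u: "character K H u"
  shows "F_obj K H \<theta> u g M
    = twist (inv_on H \<theta>) (\<lambda>h. u (inv_on H \<theta> (S h))) (inv g) M"
proof -
  have "character K H (\<lambda>h. u (inv_on H \<theta> (S h)))"
    using character_antipode[OF character_hopf_aut[OF u inv_hopf_aut[OF \<theta>]]] .
  then show ?thesis
    unfolding F_obj_def twist_def
    by (simp add: act_hit[OF M inv_hopf_aut[OF \<theta>]] cong: if_cong)
qed

text \<open>Pulling back twice composes the maps on H, hence \<open>hit\<close>, and the two factors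
  on the coaction multiply to 1. \<open>normalized\<close> settles the values outside the carriers,
  so that the records are equal.\<close>

lemma twist_twist:
  assumes M: "yd_module K H \<alpha> \<beta> M" and norm: "normalized K H M"
    and "\<theta> \<in> hopf_aut K H" "character K H u" "group_like K H c"
    and \<theta>': "\<theta>' \<in> hopf_aut K H" and u': "character K H u'" and c': "c' \<in> carrier H"
    and hit: "\<And>h. h \<in> carrier H \<Longrightarrow> \<theta> (left_hit u (\<theta>' (left_hit u' h))) = h"
    and cc': "c \<otimes> c' = \<one>"
  shows "twist \<theta>' u' c' (twist \<theta> u c M) = M"
proof -
  interpret twisting K H M \<theta> u c
    using assms hopf_module_yd[OF M] by (simp add: twisting_def twisting_axioms_def)
  note [simp] = hopf_aut_closed[OF \<theta>'] u' c'
  let ?N = "twist \<theta> u c M"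
  have "(\<lambda>h m. if h \<in> carrier H \<and> m \<in> carrier M then act ?N (\<theta>' (left_hit u' h)) m else undefined) = act M"
    using norm by (auto simp: fun_eq_iff normalized_def hit)
  moreover have "tsum MH (coact ?N m) (\<lambda>m0 m1. pure_tensor K M H m0 (m1 \<otimes> c')) = coact M m"
    if m: "m \<in> carrier M" for m
  proof -
    have "tsum MH (coact ?N m) (\<lambda>m0 m1. pure_tensor K M H m0 (m1 \<otimes> c'))
        = tsum MH (coact M m) (\<lambda>m0 m1. pure_tensor K M H m0 (m1 \<otimes> c \<otimes> c'))"
      using m by (intro tsum_coact_twist) (auto intro!: bilinear_mapI linear)
    also have "\<dots> = tsum MH (coact M m) (pure_tensor K M H)"
      using m by (intro tsum_coact_cong) (auto simp: H.m_assoc cc')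
    finally show ?thesis using m by (simp add: MH.tsum_eq_self)
  qed
  then have "(\<lambda>m\<in>carrier M. tsum MH (coact ?N m) (\<lambda>m0 m1. pure_tensor K M H m0 (m1 \<otimes> c'))) = coact M"
    using norm by (auto simp: fun_eq_iff normalized_def restrict_def simp del: twist_simps(10))
  ultimately have "twist \<theta>' u' c' ?N = ?N\<lparr>act := act M, coact := coact M\<rparr>"
    unfolding twist_def[of \<theta>' u' c'] by (simp del: twist_simps(9,10))
  then show ?thesis by (simp add: twist_def)
qed

text \<open>Both modules are twisted by the same data: linearity over H is the old one at a
  transformed element, and \<phi> on the module leg commutes with multiplication by \<open>c\<close>
  on the other. This is why the functors are the identity on morphisms.\<close>

lemma yd_hom_twist:
  assumes M: "yd_module K H \<alpha> \<beta> M" and N: "yd_module K H \<alpha> \<beta> N"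
    and \<theta>: "\<theta> \<in> hopf_aut K H" and u: "character K H u" and c: "group_like K H c"
    and \<phi>: "\<phi> \<in> yd_hom K H M N"
  shows "\<phi> \<in> yd_hom K H (twist \<theta> u c M) (twist \<theta> u c N)"
proof -
  interpret M: twisting K H M \<theta> u c
    using assms hopf_module_yd[OF M] by (simp add: twisting_def twisting_axioms_def)
  interpret N: twisting K H N \<theta> u c
    using assms hopf_module_yd[OF N] by (simp add: twisting_def twisting_axioms_def)
  have lin: "linear_map K M N \<phi>" using \<phi> by (simp add: yd_hom_def)
  note [simp] = linear_map_closed[OF lin]
  have "coact (twist \<theta> u c N) (\<phi> m)
      = tsum N.MH (coact (twist \<theta> u c M) m) (\<lambda>m0 m1. pure_tensor K N H (\<phi> m0) m1)"
    if m: "m \<in> carrier M" for m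
  proof -
    have "coact (twist \<theta> u c N) (\<phi> m) = N.shift (coact N (\<phi> m))"
      using m by (intro N.coact_twist) auto
    also have "coact N (\<phi> m) = tsum N.MH (coact M m) (\<lambda>m0 m1. pure_tensor K N H (\<phi> m0) m1)"
      using \<phi> m by (simp add: yd_hom_def)
    also have "N.shift \<dots> = tsum N.MH (coact M m) (\<lambda>m0 m1. pure_tensor K N H (\<phi> m0) (m1 \<otimes> c))"
      using m by (subst M.MH.linear_map_tsum[OF N.linear_shift])
        (auto simp: N.shift_pure N.MH.pure_tensor_closed intro!: M.tsum_coact_cong)
    also have "\<dots> = tsum N.MH (coact (twist \<theta> u c M) m) (\<lambda>m0 m1. pure_tensor K N H (\<phi> m0) m1)"
      using m by (intro M.tsum_coact_twist[symmetric])
        (auto intro!: bilinear_mapI linear lin)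
    finally show ?thesis .
  qed
  then show ?thesis
    using \<phi> by (auto simp: yd_hom_def simp del: twist_simps(10))
qed


section \<open>The functors\<close>

lemma is_category_YD: "is_category (YD K H \<alpha> \<beta> :: (('k, 'h, 'm) yd, 'm \<Rightarrow> 'm) category)"
proof -
  have ident: "restrict id (carrier M) \<in> yd_hom K H M M" if "yd_module K H \<alpha> \<beta> M" for M :: "('k, 'h, 'm) yd"
  proof -
    interpret M: hopf_module K H M using that by (rule hopf_module_yd)
    have "tsum M.MH (coact M m) (\<lambda>m0 m1. pure_tensor K M H (restrict id (carrier M) m0) m1) = coact M m"
      if "m \<in> carrier M" for m
    proof -
      have "tsum M.MH (coact M m) (\<lambda>m0 m1. pure_tensor K M H (restrict id (carrier M) m0) m1)
          = tsum M.MH (coact M m) (pure_tensor K M H)"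
        using that by (intro M.tsum_coact_cong) auto
      then show ?thesis using that by (simp add: M.MH.tsum_eq_self)
    qed
    then show ?thesis by (auto simp: yd_hom_def linear_map_def)
  qed
  have comp: "compose (carrier L) \<psi> \<phi> \<in> yd_hom K H L N"
    if L: "yd_module K H \<alpha> \<beta> L" and M: "yd_module K H \<alpha> \<beta> M" and N: "yd_module K H \<alpha> \<beta> N"
      and \<phi>: "\<phi> \<in> yd_hom K H L M" and \<psi>: "\<psi> \<in> yd_hom K H M N"
    for L M N :: "('k, 'h, 'm) yd" and \<phi> \<psi>
  proof -
    interpret L: hopf_module K H L using L by (rule hopf_module_yd)
    interpret M: hopf_module K H M using M by (rule hopf_module_yd)
    interpret N: hopf_module K H N using N by (rule hopf_module_yd)
    have lin: "linear_map K L M \<phi>" "linear_map K M N \<psi>" using \<phi> \<psi> by (auto simp: yd_hom_def)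
    note [simp] = linear_map_closed[OF lin(1)] linear_map_closed[OF lin(2)]
    have bil: "bilinear_map K M H N.MH (\<lambda>m0 m1. pure_tensor K N H (\<psi> m0) m1)"
      by (auto intro!: bilinear_mapI linear lin)
    have "coact N (compose (carrier L) \<psi> \<phi> m)
        = tsum N.MH (coact L m) (\<lambda>m0 m1. pure_tensor K N H (compose (carrier L) \<psi> \<phi> m0) m1)"
      if m: "m \<in> carrier L" for m
    proof -
      have "coact N (compose (carrier L) \<psi> \<phi> m)
          = tsum N.MH (tsum M.MH (coact L m) (\<lambda>m0 m1. pure_tensor K M H (\<phi> m0) m1))
              (\<lambda>m0 m1. pure_tensor K N H (\<psi> m0) m1)"
        using \<phi> \<psi> m by (simp add: yd_hom_def compose_eq)
      also have "\<dots> = tsum N.MH (coact L m) (\<lambda>m0 m1. tsum N.MH (pure_tensor K M H (\<phi> m0) m1)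
              (\<lambda>m0 m1. pure_tensor K N H (\<psi> m0) m1))"
        using m by (intro L.MH.linear_map_tsum[OF M.MH.linear_tsum[OF _ bil]])
          (auto intro: M.MH.pure_tensor_closed)
      also have "\<dots> = tsum N.MH (coact L m) (\<lambda>m0 m1. pure_tensor K N H (compose (carrier L) \<psi> \<phi> m0) m1)"
        using m by (intro L.tsum_coact_cong) (auto simp: M.MH.tsum_pure_tensor[OF _ bil] compose_eq)
      finally show ?thesis .
    qed
    moreover have "linear_map K L N (compose (carrier L) \<psi> \<phi>)"
      using linear_map_comp[OF lin(2,1)]
      by (subst linear_map_cong[where v="\<lambda>x. \<psi> (\<phi> x)"]) (auto simp: compose_eq)
    ultimately show ?thesis
      using \<phi> \<psi> by (auto simp: yd_hom_def compose_eq)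
  qed
  \<comment> \<open>The category laws are equalities of total functions; morphisms are extensional,
    so agreement on the carrier is enough.\<close>
  have fun_hom: "\<phi> \<in> carrier M \<rightarrow> carrier N" "\<phi> \<in> extensional (carrier M)"
    if "\<phi> \<in> yd_hom K H M N" for M N :: "('k, 'h, 'm) yd" and \<phi>
    using that by (auto simp: yd_hom_def linear_map_def)
  have "compose (carrier M) \<phi> (restrict id (carrier M)) = \<phi>"
      "compose (carrier M) (restrict id (carrier N)) \<phi> = \<phi>"
    if "\<phi> \<in> yd_hom K H M N" for M N :: "('k, 'h, 'm) yd" and \<phi>
    using fun_hom[OF that] by (auto simp: compose_def fun_eq_iff extensional_def)
  moreover have "compose (carrier L) \<chi> (compose (carrier L) \<psi> \<phi>)
      = compose (carrier L) (compose (carrier M) \<chi> \<psi>) \<phi>"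
    if "\<phi> \<in> yd_hom K H L M" for L M :: "('k, 'h, 'm) yd" and \<phi> \<psi> \<chi>
    using fun_hom[OF that] by (auto simp: compose_def fun_eq_iff)
  ultimately show ?thesis
    unfolding is_category_def using ident comp by (simp add: YD_def) blast
qed

text \<open>\<open>T\<close> stands for \<open>F_obj\<close> or \<open>G_obj\<close>, whose
  agreement with a twist is known on Yetter-Drinfeld modules.\<close>

lemma is_functor_twist:
  assumes \<theta>: "\<theta> \<in> hopf_aut K H" and u: "character K H u" and c: "group_like K H c"
    and \<alpha>: "\<alpha> \<in> hopf_aut K H" and \<beta>: "\<beta> \<in> hopf_aut K H"
    and \<alpha>': "\<alpha>' \<in> hopf_aut K H" and \<beta>': "\<beta>' \<in> hopf_aut K H"
    and \<beta>\<theta>: "\<And>h. h \<in> carrier H \<Longrightarrow> \<beta> (\<theta> h) = \<beta>' h"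
    and key: "\<And>h. h \<in> carrier H \<Longrightarrow>
      \<alpha> (inv_antipode (\<theta> (left_hit u h))) \<otimes> c = c \<otimes> \<alpha>' (inv_antipode (right_hit u h))"
    and T: "\<And>M :: ('k, 'h, 'm) yd. yd_module K H \<alpha> \<beta> M \<Longrightarrow> T M = twist \<theta> u c M"
  shows "is_functor (YD K H \<alpha> \<beta> :: (('k, 'h, 'm) yd, 'm \<Rightarrow> 'm) category) (YD K H \<alpha>' \<beta>')
    T (\<lambda>M N \<phi>. \<phi>)"
proof -
  have "yd_module K H \<alpha>' \<beta>' (twist \<theta> u c M)" if "yd_module K H \<alpha> \<beta> M" for M :: "('k, 'h, 'm) yd"
  proof -
    interpret twisting K H M \<theta> u c
      using assms hopf_module_yd[OF that] by (simp add: twisting_def twisting_axioms_def)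
    show ?thesis by (rule yd_module_twist[OF that \<alpha> \<beta> \<alpha>' \<beta>' \<beta>\<theta> key])
  qed
  moreover have "\<phi> \<in> yd_hom K H (twist \<theta> u c M) (twist \<theta> u c N)"
    if "yd_module K H \<alpha> \<beta> M" "yd_module K H \<alpha> \<beta> N" "\<phi> \<in> yd_hom K H M N"
    for M N :: "('k, 'h, 'm) yd" and \<phi>
    using yd_hom_twist[OF that(1,2) \<theta> u c that(3)] .
  ultimately show ?thesis
    by (simp add: is_functor_def is_category_YD) (simp add: YD_def T normalized_twist)
qed

lemma inverse_functors_YD:
  assumes \<alpha>: "\<alpha> \<in> hopf_aut K H" and \<beta>: "\<beta> \<in> hopf_aut K H"
    and pair: "pair_in_involution K H \<alpha> \<beta> f g"
  shows "inverse_functors (YD K H \<alpha> \<beta> :: (('k, 'h, 'm) yd, 'm \<Rightarrow> 'm) category) (YD K H id id)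
    (F_obj K H \<beta> f g) (\<lambda>M M' \<phi>. \<phi>) (G_obj K H \<beta> f g) (\<lambda>N N' \<phi>. \<phi>)"
proof -
  note f = pair_character[OF \<alpha> \<beta> pair]
  note fS = character_antipode[OF f]
  note g = pair_group_like[OF \<alpha> \<beta> pair]
  let ?\<gamma> = "inv_on H \<beta>" and ?u = "\<lambda>h. f (inv_on H \<beta> (S h))"
  note \<gamma> = inv_hopf_aut[OF \<beta>]
  note f\<gamma> = character_hopf_aut[OF f \<gamma>]
  have u: "character K H ?u" using character_antipode[OF f\<gamma>] .
  note [simp] = hopf_aut_inv_apply[OF \<beta>] hopf_aut_closed[OF \<beta>] group_like_closed[OF g]
    inv_group_like_simps[OF g] f fS u
  \<comment> \<open>\<beta> commutes with S, so \<beta>^-1 S \<beta> = S.\<close>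
  have u\<beta>: "?u (\<beta> h) = f (S h)" if "h \<in> carrier H" for h
    using that by (simp add: hopf_aut_antipode[OF \<beta>])
  have left: "left_hit ?u (\<beta> h) = \<beta> (left_hit (\<lambda>x. f (S x)) h)" if "h \<in> carrier H" for h
  proof -
    have "left_hit (\<lambda>x. ?u (\<beta> x)) h = left_hit (\<lambda>x. f (S x)) h"
      unfolding left_hit_def using that by (intro sweedler2_cong) (simp_all only: u\<beta>)
    then show ?thesis using left_hit_hopf_aut[OF u \<beta> that] by simp
  qed
  have right: "right_hit ?u (\<beta> h) = \<beta> (right_hit (\<lambda>x. f (S x)) h)" if "h \<in> carrier H" for h
  proof -
    have "right_hit (\<lambda>x. ?u (\<beta> x)) h = right_hit (\<lambda>x. f (S x)) h"
      unfolding right_hit_def using that by (intro sweedler2_cong) (simp_all only: u\<beta>)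
    then show ?thesis using right_hit_hopf_aut[OF u \<beta> that] by simp
  qed
  \<comment> \<open>The pair identity is used at \<beta>^-1(h); sliding the translations through
    \<beta> exchanges f S for u.\<close>
  have keyF: "\<alpha> (inv_antipode (?\<gamma> (left_hit ?u h))) \<otimes> inv g
      = inv g \<otimes> id (inv_antipode (right_hit ?u h))" if h: "h \<in> carrier H" for h
    using pair_inv_antipode_left[OF \<alpha> \<beta> pair, of "?\<gamma> h"] left[of "?\<gamma> h"] right[of "?\<gamma> h"] h
    by simp
  have keyG: "id (inv_antipode (\<beta> (left_hit f h))) \<otimes> g = g \<otimes> \<alpha> (inv_antipode (right_hit f h))"
    if "h \<in> carrier H" for h
    using pair_inv_antipode_right[OF \<alpha> \<beta> pair that] by simp
  note F = F_obj_twist[OF _ \<beta> f, of \<alpha> \<beta>] and G = G_obj_twist[OF _ \<beta> f, of id id]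
  have functors: "is_functor (YD K H \<alpha> \<beta> :: (('k, 'h, 'm) yd, 'm \<Rightarrow> 'm) category) (YD K H id id)
      (F_obj K H \<beta> f g) (\<lambda>M M' \<phi>. \<phi>)"
    "is_functor (YD K H id id :: (('k, 'h, 'm) yd, 'm \<Rightarrow> 'm) category) (YD K H \<alpha> \<beta>)
      (G_obj K H \<beta> f g) (\<lambda>M M' \<phi>. \<phi>)"
    by (rule is_functor_twist[where \<alpha>=\<alpha> and \<beta>=\<beta> and \<alpha>'=id and \<beta>'=id, OF \<gamma> u group_like_inv[OF g] \<alpha> \<beta> id_hopf_aut id_hopf_aut _ keyF F]; simp)
      (rule is_functor_twist[where \<alpha>=id and \<beta>=id and \<alpha>'=\<alpha> and \<beta>'=\<beta>, OF \<beta> f g id_hopf_aut id_hopf_aut \<alpha> \<beta> _ keyG G]; simp)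
  \<comment> \<open>After \<beta> has been slid through the translation, each composite reduces to
    \<lambda>_f and \<lambda>_{f S} in succession, which are mutually inverse.\<close>
  have FG: "?\<gamma> (left_hit ?u (\<beta> (left_hit f h))) = h"
    "\<beta> (left_hit f (?\<gamma> (left_hit ?u h))) = h" if h: "h \<in> carrier H" for h
  proof -
    show "?\<gamma> (left_hit ?u (\<beta> (left_hit f h))) = h"
      using h by (simp add: left left_hit_inverse[OF f fS convolution_inverse_antipode(1)[OF f]])
    show "\<beta> (left_hit f (?\<gamma> (left_hit ?u h))) = h"
      using h left[of "?\<gamma> h"]
        left_hit_inverse[OF fS f convolution_inverse_antipode(2)[OF f], of "?\<gamma> h"] by simp
  qed
  have "G_obj K H \<beta> f g (F_obj K H \<beta> f g M) = M"
    if M: "yd_module K H \<alpha> \<beta> M" "normalized K H M" for M :: "('k, 'h, 'm) yd"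
  proof -
    \<comment> \<open>\<open>G_obj\<close> is rewritten as a twist on Yetter-Drinfeld modules, so
      its argument must first be known to be one.\<close>
    have "yd_module K H id id (F_obj K H \<beta> f g M)"
      using functors(1) M by (simp add: is_functor_def) (simp add: YD_def)
    then show ?thesis
      using twist_twist[OF M \<gamma> u group_like_inv[OF g] \<beta> f _ FG(1)]
      by (simp add: G F[OF M(1)])
  qed
  moreover have "F_obj K H \<beta> f g (G_obj K H \<beta> f g M) = M"
    if M: "yd_module K H id id M" "normalized K H M" for M :: "('k, 'h, 'm) yd"
  proof -
    have "yd_module K H \<alpha> \<beta> (G_obj K H \<beta> f g M)"
      using functors(2) M by (simp add: is_functor_def) (simp add: YD_def)
    then show ?thesis
      using twist_twist[OF M \<beta> f g \<gamma> u _ FG(2)]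
      by (simp add: F G[OF M(1)])
  qed
  ultimately show ?thesis
    using functors by (simp add: inverse_functors_def) (simp add: YD_def)
qed

end

theorem theorem4p1:
  fixes K :: "'k ring" and H :: "('k, 'h) hopf"
    and \<alpha> \<beta> :: "'h \<Rightarrow> 'h" and f :: "'h \<Rightarrow> 'k" and g :: 'h
  assumes "field K"
    and "hopf_algebra K H"
    and "bij_betw (antipode H) (carrier H) (carrier H)"
    and "\<alpha> \<in> hopf_aut K H" and "\<beta> \<in> hopf_aut K H"
    and "pair_in_involution K H \<alpha> \<beta> f g"
  shows "isomorphic_categories
      (YD K H \<alpha> \<beta> :: (('k, 'h, 'm) yd, 'm \<Rightarrow> 'm) category)
      (YD K H id id :: (('k, 'h, 'm) yd, 'm \<Rightarrow> 'm) category)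
    \<and> inverse_functors
      (YD K H \<alpha> \<beta> :: (('k, 'h, 'm) yd, 'm \<Rightarrow> 'm) category)
      (YD K H id id)
      (F_obj K H \<beta> f g) (\<lambda>M M' \<phi>. \<phi>)
      (G_obj K H \<beta> f g) (\<lambda>N N' \<phi>. \<phi>)"
proof -
  interpret hopf K H using assms(2,3) by (simp add: hopf_def)
  show ?thesis
    using inverse_functors_YD[OF assms(4-6)] unfolding isomorphic_categories_def by blast
qed

end
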